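(* The Riemannian gradient of the cost function $C=S\circ E:\mathrm{SL}_d(\mathbb{R})\to\mathbb{R}$ at the point $A\in\mathrm{SL}_d(\mathbb{R})$ is given by $$\mathrm{grad}\,[C(A)]=DA,$$ where $$D=\sum_{i=1}^{d-1}\int_\Omega Q_{\le i}\,Q_{>i}\left(\nabla v(x)\,(Ax)^{\mathrm T}-\frac{\nabla v(x)^{\mathrm T}Ax}{d}\,I_{d\times d}\right)d\mu(x),$$ $v(x)=u_{\mathrm{TT}}(Ax)$, and $Q_{\le i},Q_{>i}$ are tensor cores of the orthogonalized functional tensor train $v(x)=Q_{\le i}\,\Sigma_i\,Q_{>i}$.
   Context: Setting: $\Omega\subseteq\mathbb{R}^d$ is a separable domain, such as a Cartesian product $\Omega_1\times\cdots\times\Omega_d$ of subsets of the real line, and $\mu=\prod_{i=1}^d\mu_i(x_i)$ is a finite product measure on $\Omega$. $L^2_\mu(\Omega)$ is the corresponding weighted Hilbert space. $\nabla v$ is the (column) gradient of the function $v$ with respect to $x$. Functional tensor train (FTT): an FTT tensor of rank $(r_0,r_1,\ldots,r_d)$, $r_0=r_d=1$, is a product $\Psi_1(x_1)\Psi_2(x_2)\cdots\Psi_d(x_d)$ of matrix-valued functions (cores), $\Psi_i(x_i)$ having size $r_{i-1}\times r_i$ (diagonal factors being absorbed in the cores). $u_{\mathrm{TT}}$ is a given FTT tensor in $L^2_\mu(\Omega)$. An FTT tensor $f$ can be orthogonalized in the $i$-th variable, $1\le i\le d-1$, as $f=Q_{\le i}\Sigma_iQ_{>i}$. Here $\Sigma_i=\mathrm{diag}(\sigma_i(1),\ldots,\sigma_i(r_i))$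 is a real diagonal matrix (the singular values of $f$), and $Q_{\le i}=Q_1\cdots Q_i$ (a $1\times r_i$ row of functions of $x_{\le i}=(x_1,\ldots,x_i)$) and $Q_{>i}=Q_{i+1}\cdots Q_d$ (an $r_i\times 1$ column of functions of $x_{>i}=(x_{i+1},\ldots,x_d)$) satisfy $\int Q_{\le i}^{\mathrm T}Q_{\le i}\,d\mu_{\le i}=I_{r_i\times r_i}$ and $\int Q_{>i}Q_{>i}^{\mathrm T}\,d\mu_{>i}=I_{r_i\times r_i}$, with $\mu_{\le i}=\mu_1\cdots\mu_i$ and $\mu_{>i}=\mu_{i+1}\cdots\mu_d$ integrated over the corresponding domains $\Omega_{\le i}$, $\Omega_{>i}$. Cost function: $S:L^2_\mu(\Omega)\to\mathbb{R}$ sends a tensor to the sum $\sum_{i=1}^{d-1}\sum_{\alpha_i=1}^{r_i}\sigma_i(\alpha_i)$ of all its singular values, and $E:\mathrm{SL}_d(\mathbb{R})\to L^2_\mu(\Omega)$ is the evaluation map $A\mapsto u_{\mathrm{TT}}(Ax)$. Riemannian structure: $\mathrm{SL}_d(\mathbb{R})$ is the group of real $d\times d$ matrices with determinant $1$, with tangent space $T_A\mathrm{SL}_d(\mathbb{R})=\{NA:\ N\in\mathbb{R}^{d\times d},\ \mathrm{trace}(N)=0\}$ and Riemannian metric $(V,W)_A=\mathrm{trace}[(VA^{-1})(WA^{-1})^{\mathrm T}]$. For a smooth function $f$ on $\mathrm{SL}_d(\mathbb{R})$, the directional derivative at $A$ in direction $V\in T_A\mathrm{SL}_d(\mathbb{R})$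 is $(d_Af)V=\frac{\partial}{\partial\epsilon}f(\Theta(\epsilon))|_{\epsilon=0}$, where $\Theta$ is a smooth curve on $\mathrm{SL}_d(\mathbb{R})$ passing through $A$ at $\epsilon=0$ with velocity $V$. The Riemannian gradient $\mathrm{grad}\,f(A)$ is the unique tangent vector with $(d_Af)V=(\mathrm{grad}\,f(A),V)_A$ for all $V\in T_A\mathrm{SL}_d(\mathbb{R})$.
   Formalization: ∇v(x) is read as the gradient of u_TT at the point Ax (the gradient of x ↦ u_TT(Ax) gives a wrong sign for A = −I); C is assumed differentiable at A, E differentiable at A in the L² norm, u_TT differentiable at Ax for x in Ω, and S finite on the range of E. *)

theory Defs
  imports "HOL-Analysis.Analysis"
begin

section \<open>Coordinates and product measures\<close>

text \<open>
  The variables \<open>x\<^sub>1, \<dots>, x\<^sub>d\<close> of a vector \<open>x :: real ^ 'n\<close>, \<open>d = CARD('n)\<close>, are its components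
  listed along the linear order of the index type; \<open>pos\<close> is the order isomorphism onto
  \<open>{1..d}\<close>.
\<close>

definition pos :: "'n::{finite,linorder} \<Rightarrow> nat"
  where "pos j = card {..j}"

text \<open>\<open>vars I x\<close> is the subfamily of the variables with positions in \<open>I\<close>, an element of the
  space of \<open>Pi\<^sub>M I \<mu>\<close>; thus \<open>x\<^bsub>\<le>i\<^esub> = vars {1..i} x\<close> and \<open>x\<^bsub>>i\<^esub> = vars {i<..d} x\<close>.\<close>

definition vars :: "nat set \<Rightarrow> real ^ 'n::{finite,linorder} \<Rightarrow> nat \<Rightarrow> real"
  where "vars I x = (\<lambda>k\<in>I. x $ inv pos k)"

definition separable_domain :: "(nat \<Rightarrow> real set) \<Rightarrow> (real ^ 'n::{finite,linorder}) set"
  where "separable_domain \<Omega> = {x. \<forall>j. x $ j \<in> \<Omega> (pos j)}"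

text \<open>The \<open>k\<close>-th factor \<open>\<mu> k\<close> is a measure whose space is the subset \<open>\<Omega>\<^sub>k\<close> of the real line.\<close>

definition product_measure :: "(nat \<Rightarrow> real measure) \<Rightarrow> (real ^ 'n::{finite,linorder}) measure"
  where "product_measure \<mu> =
    distr (Pi\<^sub>M {1..CARD('n)} \<mu>)
      (restrict_space borel (separable_domain (\<lambda>k. space (\<mu> k))))
      (\<lambda>y. \<chi> j. y (pos j))"

definition square_integrable :: "'a measure \<Rightarrow> ('a \<Rightarrow> real) \<Rightarrow> bool"
  where "square_integrable M f \<longleftrightarrow> f \<in> borel_measurable M \<and> integrable M (\<lambda>x. (f x)\<^sup>2)"

definition L2norm :: "'a measure \<Rightarrow> ('a \<Rightarrow> real) \<Rightarrow> real"
  where "L2norm M f = sqrt (LINT x|M. (f x)\<^sup>2)"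

definition L2_orthonormal :: "'a measure \<Rightarrow> nat set \<Rightarrow> (nat \<Rightarrow> 'a \<Rightarrow> real) \<Rightarrow> bool"
  where "L2_orthonormal M J q \<longleftrightarrow>
    (\<forall>\<alpha>\<in>J. square_integrable M (q \<alpha>)) \<and>
    (\<forall>\<alpha>\<in>J. \<forall>\<beta>\<in>J. (LINT y|M. q \<alpha> y * q \<beta> y) = (if \<alpha> = \<beta> then 1 else 0))"


section \<open>Functional tensor trains\<close>

text \<open>
  A family of cores is \<open>\<Psi> :: nat \<Rightarrow> real \<Rightarrow> nat \<Rightarrow> nat \<Rightarrow> real\<close>, where \<open>\<Psi> k t \<alpha> \<beta>\<close> is the
  \<open>(\<alpha>, \<beta>)\<close> entry of the matrix \<open>\<Psi>\<^sub>k(t)\<close>; only the entries with \<open>1 \<le> \<alpha> \<le> r (k - 1)\<close> and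
  \<open>1 \<le> \<beta> \<le> r k\<close> matter. \<open>core_prod r \<Psi> i n y\<close> is the matrix
  \<open>\<Psi>\<^bsub>i+1\<^esub>(y\<^bsub>i+1\<^esub>) \<cdots> \<Psi>\<^bsub>i+n\<^esub>(y\<^bsub>i+n\<^esub>)\<close> of size \<open>r i \<times> r (i + n)\<close>.
\<close>

primrec core_prod ::
    "(nat \<Rightarrow> nat) \<Rightarrow> (nat \<Rightarrow> real \<Rightarrow> nat \<Rightarrow> nat \<Rightarrow> real) \<Rightarrow> nat \<Rightarrow> nat \<Rightarrow> (nat \<Rightarrow> real) \<Rightarrow> nat \<Rightarrow> nat \<Rightarrow> real"
  where
    "core_prod r \<Psi> i 0 y \<alpha> \<beta> = (if \<alpha> = \<beta> then 1 else 0)"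
  | "core_prod r \<Psi> i (Suc n) y \<alpha> \<beta> =
      (\<Sum>\<gamma>=1..r (i + n). core_prod r \<Psi> i n y \<alpha> \<gamma> * \<Psi> (i + n + 1) (y (i + n + 1)) \<gamma> \<beta>)"

definition is_FTT ::
    "(nat \<Rightarrow> nat) \<Rightarrow> (nat \<Rightarrow> real \<Rightarrow> nat \<Rightarrow> nat \<Rightarrow> real) \<Rightarrow> (real ^ 'n::{finite,linorder} \<Rightarrow> real) \<Rightarrow> bool"
  where "is_FTT r \<Psi> f \<longleftrightarrow> r 0 = 1 \<and> r CARD('n) = 1 \<and>
    (\<forall>x. f x = core_prod r \<Psi> 0 CARD('n) (vars {1..CARD('n)} x) 1 1)"

text \<open>The entries of the row \<open>Q\<^bsub>\<le>i\<^esub> = Q\<^sub>1 \<cdots> Q\<^sub>i\<close> and of the column \<open>Q\<^bsub>>i\<^esub> = Q\<^bsub>i+1\<^esub> \<cdots> Q\<^sub>d\<close>.\<close>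

definition Q_le ::
    "(nat \<Rightarrow> nat) \<Rightarrow> (nat \<Rightarrow> real \<Rightarrow> nat \<Rightarrow> nat \<Rightarrow> real) \<Rightarrow> nat \<Rightarrow> nat \<Rightarrow> (nat \<Rightarrow> real) \<Rightarrow> real"
  where "Q_le r Q i \<alpha> y = core_prod r Q 0 i y 1 \<alpha>"

definition Q_gt ::
    "(nat \<Rightarrow> nat) \<Rightarrow> (nat \<Rightarrow> real \<Rightarrow> nat \<Rightarrow> nat \<Rightarrow> real) \<Rightarrow> nat \<Rightarrow> nat \<Rightarrow> nat \<Rightarrow> (nat \<Rightarrow> real) \<Rightarrow> real"
  where "Q_gt r Q d i \<alpha> y = core_prod r Q i (d - i) y \<alpha> 1"

text \<open>
  \<open>f = Q\<^bsub>\<le>i\<^esub> \<Sigma>\<^sub>i Q\<^bsub>>i\<^esub>\<close> in \<open>L\<^sup>2\<close>, with \<open>\<Sigma>\<^sub>i = diag (\<sigma> 1, \<dots>, \<sigma> (r i))\<close>. The cores are allowed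
  to change with \<open>i\<close>, so \<open>Q\<close> and \<open>\<sigma>\<close> belong to one fixed \<open>i\<close> here.
\<close>

definition orthogonalized_FTT ::
    "(nat \<Rightarrow> real measure) \<Rightarrow> nat \<Rightarrow> (real ^ 'n::{finite,linorder} \<Rightarrow> real) \<Rightarrow>
     (nat \<Rightarrow> nat) \<Rightarrow> (nat \<Rightarrow> real \<Rightarrow> nat \<Rightarrow> nat \<Rightarrow> real) \<Rightarrow> (nat \<Rightarrow> real) \<Rightarrow> bool"
  where "orthogonalized_FTT \<mu> i f r Q \<sigma> \<longleftrightarrow>
    r 0 = 1 \<and> r CARD('n) = 1 \<and>
    (\<forall>\<alpha>\<in>{1..r i}. 0 \<le> \<sigma> \<alpha>) \<and>
    L2_orthonormal (Pi\<^sub>M {1..i} \<mu>) {1..r i} (Q_le r Q i) \<and>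
    L2_orthonormal (Pi\<^sub>M {i<..CARD('n)} \<mu>) {1..r i} (Q_gt r Q CARD('n) i) \<and>
    (AE x in product_measure \<mu>. f x =
      (\<Sum>\<alpha>=1..r i. Q_le r Q i \<alpha> (vars {1..i} x) * \<sigma> \<alpha> * Q_gt r Q CARD('n) i \<alpha> (vars {i<..CARD('n)} x)))"


section \<open>The sum of all singular values\<close>

text \<open>
  Singular values of an arbitrary \<open>f \<in> L\<^sup>2\<close> with respect to the splitting \<open>(x\<^bsub>\<le>i\<^esub>, x\<^bsub>>i\<^esub>)\<close> of the
  variables. A rank \<open>r = \<infinity>\<close> is allowed, since \<open>u(Bx)\<close> need not have finite rank when \<open>u\<close>
  has; the expansion of \<open>f\<close> converges in \<open>L\<^sup>2\<close>. For finite \<open>r\<close> the partial sums are eventually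
  constant, so the last conjunct is the equality \<open>f = Q\<^bsub>\<le>i\<^esub> \<Sigma>\<^sub>i Q\<^bsub>>i\<^esub>\<close> almost everywhere.
\<close>

definition rank_indices :: "enat \<Rightarrow> nat set"
  where "rank_indices r = {\<alpha>. 1 \<le> \<alpha> \<and> enat \<alpha> \<le> r}"

definition singular_system ::
    "(nat \<Rightarrow> real measure) \<Rightarrow> nat \<Rightarrow> (real ^ 'n::{finite,linorder} \<Rightarrow> real) \<Rightarrow>
     enat \<Rightarrow> (nat \<Rightarrow> real) \<Rightarrow> (nat \<Rightarrow> (nat \<Rightarrow> real) \<Rightarrow> real) \<Rightarrow> (nat \<Rightarrow> (nat \<Rightarrow> real) \<Rightarrow> real) \<Rightarrow> bool"
  where "singular_system \<mu> i f r \<sigma> q p \<longleftrightarrow>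
    square_integrable (product_measure \<mu>) f \<and>
    (\<forall>\<alpha>\<in>rank_indices r. 0 \<le> \<sigma> \<alpha>) \<and>
    L2_orthonormal (Pi\<^sub>M {1..i} \<mu>) (rank_indices r) q \<and>
    L2_orthonormal (Pi\<^sub>M {i<..CARD('n)} \<mu>) (rank_indices r) p \<and>
    (\<lambda>n. L2norm (product_measure \<mu>) (\<lambda>x. f x -
      (\<Sum>\<alpha>\<in>rank_indices r \<inter> {..n}. q \<alpha> (vars {1..i} x) * \<sigma> \<alpha> * p \<alpha> (vars {i<..CARD('n)} x))))
      \<longlonglongrightarrow> 0"

definition has_singular_value_sum ::
    "(nat \<Rightarrow> real measure) \<Rightarrow> nat \<Rightarrow> (real ^ 'n::{finite,linorder} \<Rightarrow> real) \<Rightarrow> real \<Rightarrow> bool"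
  where "has_singular_value_sum \<mu> i f s \<longleftrightarrow>
    (\<exists>r \<sigma> q p. singular_system \<mu> i f r \<sigma> q p \<and> (\<sigma> has_sum s) (rank_indices r))"

definition S_cost :: "(nat \<Rightarrow> real measure) \<Rightarrow> (real ^ 'n::{finite,linorder} \<Rightarrow> real) \<Rightarrow> real"
  where "S_cost \<mu> f = (\<Sum>i\<in>{1..<CARD('n)}. THE s. has_singular_value_sum \<mu> i f s)"

definition E_eval :: "(real ^ 'n \<Rightarrow> real) \<Rightarrow> real ^ 'n ^ 'n \<Rightarrow> real ^ 'n \<Rightarrow> real"
  where "E_eval u A = (\<lambda>x. u (A *v x))"


section \<open>The Riemannian manifold \<open>SL\<^sub>d(\<real>)\<close>\<close>

definition SL :: "(real ^ 'n ^ 'n) set"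
  where "SL = {A. det A = 1}"

definition SL_tangent :: "real ^ 'n ^ 'n \<Rightarrow> (real ^ 'n ^ 'n) set"
  where "SL_tangent A = {N ** A | N. trace N = 0}"

definition SL_metric :: "real ^ 'n ^ 'n \<Rightarrow> real ^ 'n ^ 'n \<Rightarrow> real ^ 'n ^ 'n \<Rightarrow> real"
  where "SL_metric A V W = trace ((V ** matrix_inv A) ** transpose (W ** matrix_inv A))"

text \<open>Infinitely differentiable curves in \<open>SL\<close>; \<open>F k\<close> is the \<open>k\<close>-th derivative.\<close>

definition smooth_SL_curve :: "real ^ 'n ^ 'n \<Rightarrow> real ^ 'n ^ 'n \<Rightarrow> (real \<Rightarrow> real ^ 'n ^ 'n) \<Rightarrow> bool"
  where "smooth_SL_curve A V \<Theta> \<longleftrightarrow>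
    (\<exists>\<delta>>0. (\<forall>t\<in>{-\<delta><..<\<delta>}. \<Theta> t \<in> SL) \<and>
      (\<exists>F. (\<forall>t\<in>{-\<delta><..<\<delta>}. F 0 t = \<Theta> t) \<and>
        (\<forall>k. \<forall>t\<in>{-\<delta><..<\<delta>}. (F k has_vector_derivative F (Suc k) t) (at t)))) \<and>
    \<Theta> 0 = A \<and> (\<Theta> has_vector_derivative V) (at 0)"

text \<open>\<open>(d\<^sub>A f) V = c\<close>.\<close>

definition has_directional_derivative ::
    "(real ^ 'n ^ 'n \<Rightarrow> real) \<Rightarrow> real ^ 'n ^ 'n \<Rightarrow> real ^ 'n ^ 'n \<Rightarrow> real \<Rightarrow> bool"
  where "has_directional_derivative f A V c \<longleftrightarrow>
    (\<forall>\<Theta>. smooth_SL_curve A V \<Theta> \<longrightarrow> ((\<lambda>\<epsilon>. f (\<Theta> \<epsilon>)) has_real_derivative c) (at 0))"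

text \<open>The same for a map with values in \<open>L\<^sup>2\<close>, the difference quotients converging in the
  \<open>L\<^sup>2\<close> norm.\<close>

definition has_L2_directional_derivative ::
    "'a measure \<Rightarrow> (real ^ 'n ^ 'n \<Rightarrow> 'a \<Rightarrow> real) \<Rightarrow> real ^ 'n ^ 'n \<Rightarrow> real ^ 'n ^ 'n \<Rightarrow> ('a \<Rightarrow> real) \<Rightarrow> bool"
  where "has_L2_directional_derivative M f A V w \<longleftrightarrow>
    square_integrable M w \<and>
    (\<forall>\<Theta>. smooth_SL_curve A V \<Theta> \<longrightarrow>
      ((\<lambda>\<epsilon>. L2norm M (\<lambda>x. (f (\<Theta> \<epsilon>) x - f A x) / \<epsilon> - w x)) \<longlongrightarrow> 0) (at 0))"

definition is_riemannian_gradient ::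
    "(real ^ 'n ^ 'n \<Rightarrow> real) \<Rightarrow> real ^ 'n ^ 'n \<Rightarrow> real ^ 'n ^ 'n \<Rightarrow> bool"
  where "is_riemannian_gradient f A G \<longleftrightarrow>
    G \<in> SL_tangent A \<and> (\<forall>V\<in>SL_tangent A. has_directional_derivative f A V (SL_metric A G V))"

definition riemannian_grad :: "(real ^ 'n ^ 'n \<Rightarrow> real) \<Rightarrow> real ^ 'n ^ 'n \<Rightarrow> real ^ 'n ^ 'n"
  where "riemannian_grad f A = (THE G. is_riemannian_gradient f A G)"


section \<open>The matrix \<open>D\<close>\<close>

text \<open>Column vector of the partial derivatives.\<close>

definition gradient :: "(real ^ 'n \<Rightarrow> real) \<Rightarrow> real ^ 'n \<Rightarrow> real ^ 'n"
  where "gradient f x = (\<chi> j. frechet_derivative f (at x) (axis j 1))"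

text \<open>\<open>a b\<^sup>T\<close> for column vectors \<open>a\<close>, \<open>b\<close>.\<close>

definition outer :: "real ^ 'n \<Rightarrow> real ^ 'm \<Rightarrow> real ^ 'm ^ 'n"
  where "outer a b = (\<chi> i j. a $ i * b $ j)"

text \<open>
  The symbol \<open>\<nabla>v(x)\<close>, \<open>v(x) = u(Ax)\<close>, in the formula for \<open>D\<close> stands for the gradient of \<open>u\<close> at
  the point \<open>Ax\<close>, as the chain rule
  \<open>d/d\<epsilon> u(exp (\<epsilon>N) A x) = \<nabla>u(Ax)\<^sup>T N A x\<close> at \<open>\<epsilon> = 0\<close> requires. The gradient of the composite
  \<open>x \<mapsto> u(Ax)\<close> is \<open>A\<^sup>T \<nabla>u(Ax)\<close>; with it the formula would have the wrong sign for \<open>A = -I\<close> and even \<open>d\<close>.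
  The cores \<open>Q i\<close> come from the orthogonalization of \<open>v\<close> in the \<open>i\<close>-th variable.
\<close>

definition D_matrix ::
    "(nat \<Rightarrow> real measure) \<Rightarrow> (real ^ 'n::{finite,linorder} \<Rightarrow> real) \<Rightarrow> real ^ 'n::{finite,linorder} ^ 'n::{finite,linorder} \<Rightarrow>
     (nat \<Rightarrow> nat) \<Rightarrow> (nat \<Rightarrow> nat \<Rightarrow> real \<Rightarrow> nat \<Rightarrow> nat \<Rightarrow> real) \<Rightarrow> real ^ 'n::{finite,linorder} ^ 'n::{finite,linorder}"
  where "D_matrix \<mu> u A r Q =
    (\<Sum>i\<in>{1..<CARD('n)}. LINT x|product_measure \<mu>.
      (\<Sum>\<alpha>=1..r i. Q_le r (Q i) i \<alpha> (vars {1..i} x) * Q_gt r (Q i) CARD('n) i \<alpha> (vars {i<..CARD('n)} x)) *\<^sub>R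
      (outer (gradient u (A *v x)) (A *v x)
        - ((gradient u (A *v x) \<bullet> (A *v x)) / real CARD('n)) *\<^sub>R mat 1))"

end

theory Submission
  imports Defs
begin

text \<open>
  The sum of the singular values of a tensor with respect to one splitting of the variables is its
  nuclear norm, the support function of the set of partial isometries. Thus
  \<open>\<langle>f, h\<rangle> \<le> S\<^sub>i(f)\<close> for every \<open>h = \<Sum>\<^sub>\<alpha> q\<^sub>\<alpha> \<otimes> p\<^sub>\<alpha>\<close> with orthonormal families (\<open>pairing_le_singular_value_sum\<close>), and
  equality holds when \<open>q\<close> and \<open>p\<close> are the singular functions of \<open>f\<close>
  (\<open>pairing_with_own_singular_functions\<close>).

  Let \<open>h\<^sub>i = Q\<^bsub>\<le>i\<^esub> Q\<^bsub>>i\<^esub>\<close> be formed from the orthogonalization of \<open>v = E(A)\<close>. On a curve \<open>\<Theta>\<close> in \<open>SL\<^sub>d\<close> through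
  \<open>A\<close> the function \<open>C(\<Theta>(\<epsilon>)) - \<Sum>\<^sub>i \<langle>E(\<Theta>(\<epsilon>)), h\<^sub>i\<rangle>\<close> is nonnegative and vanishes at \<open>\<epsilon> = 0\<close>. Its derivative
  there is \<open>0\<close>, so the derivative of the cost equals \<open>\<Sum>\<^sub>i \<langle>w, h\<^sub>i\<rangle>\<close> for the \<open>L\<^sup>2\<close> derivative \<open>w\<close> of \<open>E\<close>
  (\<open>S_cost_directional_derivative_eq\<close>). In this way multiple and vanishing
  singular values, where singular functions may vary discontinuously, are covered as well.

  It remains to read this as an inner product. For the velocity \<open>V = N A\<close>, the derivative \<open>w\<close> is
  \<open>\<nabla>u(Ax)\<^sup>T N A x\<close> almost everywhere (\<open>L2_directional_derivative_eq_gradient\<close>). For traceless \<open>N\<close> this is the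
  Frobenius product of \<open>N\<close> with the traceless part of \<open>\<nabla>u(Ax) (Ax)\<^sup>T\<close>, and integrating against the \<open>h\<^sub>i\<close>
  gives the Frobenius product of \<open>N\<close> with \<open>D\<close> (\<open>frobenius_integral_traceless_outer\<close>), which is the Riemannian metric at \<open>A\<close> of
  \<open>D A\<close> and \<open>N A\<close>. That the integrand of \<open>D\<close> is integrable, and that the gradient is unique, is
  tested on straight lines \<open>(I + t N) A\<close> in \<open>SL\<^sub>d\<close> whose directions span the traceless matrices.
\<close>

section \<open>Square-integrable functions\<close>

lemma square_integrable_imp_integrable_mult:
  assumes "square_integrable M f" "square_integrable M g"
  shows "integrable M (\<lambda>x. f x * g x)"
proof (rule Bochner_Integration.integrable_bound)
  show "integrable M (\<lambda>x. (f x)\<^sup>2 + (g x)\<^sup>2)"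
    using assms by (auto simp: square_integrable_def)
  show "(\<lambda>x. f x * g x) \<in> borel_measurable M"
    using assms by (auto simp: square_integrable_def)
  show "AE x in M. norm (f x * g x) \<le> norm ((f x)\<^sup>2 + (g x)\<^sup>2)"
  proof (intro AE_I2)
    fix x
    have "2 * (\<bar>f x\<bar> * \<bar>g x\<bar>) \<le> (f x)\<^sup>2 + (g x)\<^sup>2"
      using sum_squares_bound[of "\<bar>f x\<bar>" "\<bar>g x\<bar>"] by (simp add: mult.assoc)
    moreover have "0 \<le> \<bar>f x\<bar> * \<bar>g x\<bar>" by simp
    ultimately have "\<bar>f x\<bar> * \<bar>g x\<bar> \<le> (f x)\<^sup>2 + (g x)\<^sup>2" by linarith
    then show "norm (f x * g x) \<le> norm ((f x)\<^sup>2 + (g x)\<^sup>2)"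
      by (simp add: abs_mult)
  qed
qed

lemma square_integrable_scale:
  "square_integrable M f \<Longrightarrow> square_integrable M (\<lambda>x. c * f x)"
  by (auto simp: square_integrable_def power_mult_distrib)

lemma square_integrable_add:
  assumes "square_integrable M f" "square_integrable M g"
  shows "square_integrable M (\<lambda>x. f x + g x)"
  using assms square_integrable_imp_integrable_mult[OF assms]
  by (auto simp: square_integrable_def power2_sum mult.assoc)

lemma square_integrable_diff:
  assumes "square_integrable M f" "square_integrable M g"
  shows "square_integrable M (\<lambda>x. f x - g x)"
  using square_integrable_add[OF assms(1) square_integrable_scale[OF assms(2), of "-1"]] by simp

lemma square_integrable_sum:
  assumes "\<And>i. i \<in> I \<Longrightarrow> square_integrable M (f i)"
  shows "square_integrable M (\<lambda>x. \<Sum>i\<in>I. f i x)"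
  using assms
proof (induction I rule: infinite_finite_induct)
  case (insert i I)
  then show ?case by (simp add: square_integrable_add)
qed (auto simp: square_integrable_def)

lemma square_integrable_cong_AE:
  assumes "square_integrable M f" "g \<in> borel_measurable M" "AE x in M. f x = g x"
  shows "square_integrable M g"
proof -
  have "integrable M (\<lambda>x. (g x)\<^sup>2)"
    by (rule integrable_cong_AE_imp[where g="\<lambda>x. (f x)\<^sup>2"])
      (use assms in \<open>auto simp: square_integrable_def\<close>)
  with assms(2) show ?thesis by (simp add: square_integrable_def)
qed

lemma L2_Cauchy_Schwarz:
  assumes f: "square_integrable M f" and g: "square_integrable M g"
  shows "\<bar>LINT x|M. f x * g x\<bar> \<le> L2norm M f * L2norm M g"
proof -
  define a b c where "a = (LINT x|M. (f x)\<^sup>2)" and "b = (LINT x|M. f x * g x)"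
    and "c = (LINT x|M. (g x)\<^sup>2)"
  have fg: "integrable M (\<lambda>x. f x * g x)"
    by (rule square_integrable_imp_integrable_mult[OF f g])
  have a0: "0 \<le> a" and c0: "0 \<le> c"
    by (simp_all add: a_def c_def)
  have quad: "0 \<le> s\<^sup>2 * a + 2 * s * t * b + t\<^sup>2 * c" for s t
  proof -
    have "(LINT x|M. (s * f x + t * g x)\<^sup>2)
        = (LINT x|M. s\<^sup>2 * (f x)\<^sup>2 + 2 * s * t * (f x * g x) + t\<^sup>2 * (g x)\<^sup>2)"
      by (intro Bochner_Integration.integral_cong) (auto simp: power2_sum power_mult_distrib algebra_simps)
    also have "\<dots> = s\<^sup>2 * a + 2 * s * t * b + t\<^sup>2 * c"
      using f g fg by (simp add: square_integrable_def a_def b_def c_def)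
    finally show ?thesis
      using Bochner_Integration.integral_nonneg[of M "\<lambda>x. (s * f x + t * g x)\<^sup>2"] by simp
  qed
  have "b\<^sup>2 \<le> a * c"
  proof (cases "c = 0")
    case True
    have "b = 0"
    proof (rule ccontr)
      assume "b \<noteq> 0"
      \<comment> \<open>For \<open>a = \<integral> f\<^sup>2\<close>, \<open>c = 0\<close> and these coefficients the quadratic form takes the value \<open>- 1\<close>.\<close>
      with quad[of 1 "- (a + 1) / (2 * b)"] True show False
        by (simp add: field_simps)
    qed
    with True show ?thesis by simp
  next
    case False
    have "0 \<le> c * (a * c - b\<^sup>2)"
      using quad[of c "- b"] by (simp add: power2_eq_square algebra_simps)
    with False c0 show ?thesis
      by (simp add: zero_le_mult_iff)
  qed
  then have "sqrt (b\<^sup>2) \<le> sqrt a * sqrt c"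
    by (simp only: real_sqrt_le_iff flip: real_sqrt_mult)
  then show ?thesis
    by (simp add: a_def b_def c_def L2norm_def)
qed

lemma L2_inner_continuous:
  assumes "square_integrable M h" "square_integrable M w"
    and "\<forall>\<^sub>F t in F. square_integrable M (f t)"
    and lim: "((\<lambda>t. L2norm M (\<lambda>x. f t x - w x)) \<longlongrightarrow> 0) F"
  shows "((\<lambda>t. LINT x|M. f t x * h x) \<longlongrightarrow> (LINT x|M. w x * h x)) F"
proof (rule LIM_zero_cancel, rule Lim_null_comparison)
  show "((\<lambda>t. L2norm M (\<lambda>x. f t x - w x) * L2norm M h) \<longlongrightarrow> 0) F"
    by (rule tendsto_mult_left_zero[OF lim])
  show "\<forall>\<^sub>F t in F. norm ((LINT x|M. f t x * h x) - (LINT x|M. w x * h x))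
      \<le> L2norm M (\<lambda>x. f t x - w x) * L2norm M h"
    using assms(3)
  proof eventually_elim
    case (elim t)
    have "(LINT x|M. f t x * h x) - (LINT x|M. w x * h x) = (LINT x|M. (f t x - w x) * h x)"
      using square_integrable_imp_integrable_mult[OF elim assms(1)]
        square_integrable_imp_integrable_mult[OF assms(2) assms(1)]
      by (simp add: left_diff_distrib)
    then show ?case
      using L2_Cauchy_Schwarz[OF square_integrable_diff[OF elim assms(2)] assms(1)] by simp
  qed
qed

text \<open>By Fatou, \<open>\<integral> (g - w)\<^sup>2 \<le> liminf \<integral> (f\<^sub>n - w)\<^sup>2 = 0\<close>. As a pointwise limit on the whole space, \<open>g\<close> is
  measurable for the sigma-algebra of \<open>M\<close> itself and not only for its completion; this is what
  later makes the integrand of the gradient formula measurable.\<close>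

lemma L2_limit_eq_pointwise_limit:
  fixes f :: "nat \<Rightarrow> 'a \<Rightarrow> real"
  assumes w: "square_integrable M w"
    and f: "\<forall>\<^sub>F n in sequentially. square_integrable M (f n)"
    and L2: "(\<lambda>n. L2norm M (\<lambda>x. f n x - w x)) \<longlonglongrightarrow> 0"
    and pw: "\<And>x. x \<in> space M \<Longrightarrow> (\<lambda>n. f n x) \<longlonglongrightarrow> g x"
  shows "g \<in> borel_measurable M" "AE x in M. w x = g x"
proof -
  from f obtain N where N: "\<And>n. square_integrable M (f (n + N))"
    unfolding eventually_sequentially by (metis le_add2)
  have [measurable]: "w \<in> borel_measurable M" "f (n + N) \<in> borel_measurable M" for n
    using w N[of n] by (auto simp: square_integrable_def)
  have pw': "(\<lambda>n. f (n + N) x) \<longlonglongrightarrow> g x" if "x \<in> space M" for x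
    using pw[OF that] by (rule LIMSEQ_ignore_initial_segment)
  show [measurable]: "g \<in> borel_measurable M"
    by (rule borel_measurable_LIMSEQ_metric[where f="\<lambda>n. f (n + N)"]) (use pw' in auto)
  have nn: "(\<integral>\<^sup>+x. ennreal ((f (n + N) x - w x)\<^sup>2) \<partial>M)
      = ennreal ((L2norm M (\<lambda>x. f (n + N) x - w x))\<^sup>2)" for n
    using square_integrable_diff[OF N[of n] w]
    by (simp add: L2norm_def square_integrable_def nn_integral_eq_integral)
  have "(\<integral>\<^sup>+x. ennreal ((g x - w x)\<^sup>2) \<partial>M)
      = (\<integral>\<^sup>+x. liminf (\<lambda>n. ennreal ((f (n + N) x - w x)\<^sup>2)) \<partial>M)"
  proof (rule nn_integral_cong)
    fix x assume "x \<in> space M"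
    then have "(\<lambda>n. ennreal ((f (n + N) x - w x)\<^sup>2)) \<longlonglongrightarrow> ennreal ((g x - w x)\<^sup>2)"
      by (intro tendsto_ennrealI tendsto_power tendsto_diff pw' tendsto_const)
    then show "ennreal ((g x - w x)\<^sup>2) = liminf (\<lambda>n. ennreal ((f (n + N) x - w x)\<^sup>2))"
      by (rule lim_imp_Liminf[OF sequentially_bot, symmetric])
  qed
  also have "\<dots> \<le> liminf (\<lambda>n. \<integral>\<^sup>+x. ennreal ((f (n + N) x - w x)\<^sup>2) \<partial>M)"
    by (rule nn_integral_liminf) measurable
  also have "\<dots> = 0"
  proof -
    have "(\<lambda>n. L2norm M (\<lambda>x. f (n + N) x - w x)) \<longlonglongrightarrow> 0"
      using L2 by (rule LIMSEQ_ignore_initial_segment)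
    then have "(\<lambda>n. ennreal ((L2norm M (\<lambda>x. f (n + N) x - w x))\<^sup>2)) \<longlonglongrightarrow> ennreal (0\<^sup>2)"
      by (intro tendsto_ennrealI tendsto_power)
    then show ?thesis
      by (simp add: nn lim_imp_Liminf)
  qed
  finally have "AE x in M. ennreal ((g x - w x)\<^sup>2) = 0"
    by (subst (asm) le_zero_eq) (simp add: nn_integral_0_iff_AE)
  then show "AE x in M. w x = g x"
    by eventually_elim (simp add: ennreal_eq_0_iff)
qed

lemma L2_orthonormal_subset:
  "L2_orthonormal M J q \<Longrightarrow> I \<subseteq> J \<Longrightarrow> L2_orthonormal M I q"
  unfolding L2_orthonormal_def by blast

text \<open>Bessel: \<open>0 \<le> \<integral> (f - g)\<^sup>2\<close> for the orthogonal projection \<open>g\<close> of \<open>f\<close> onto the span of the family.\<close>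

lemma L2_orthonormal_Bessel:
  assumes f: "square_integrable M f" and e: "L2_orthonormal M J e" and J: "finite J"
  shows "(\<Sum>\<alpha>\<in>J. (LINT x|M. f x * e \<alpha> x)\<^sup>2) \<le> (LINT x|M. (f x)\<^sup>2)"
proof -
  define c where "c \<alpha> = (LINT x|M. f x * e \<alpha> x)" for \<alpha>
  define g where "g x = (\<Sum>\<alpha>\<in>J. c \<alpha> * e \<alpha> x)" for x
  have e2: "square_integrable M (e \<alpha>)" if "\<alpha> \<in> J" for \<alpha>
    using e that by (simp add: L2_orthonormal_def)
  have g2: "square_integrable M g"
    unfolding g_def[abs_def] by (intro square_integrable_sum square_integrable_scale e2)
  have inner_g: "(LINT x|M. h x * g x) = (\<Sum>\<alpha>\<in>J. c \<alpha> * (LINT x|M. h x * e \<alpha> x))"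
    if "square_integrable M h" for h
  proof -
    have "(LINT x|M. h x * g x) = (LINT x|M. (\<Sum>\<alpha>\<in>J. c \<alpha> * (h x * e \<alpha> x)))"
      by (simp add: g_def sum_distrib_left mult.left_commute)
    also have "\<dots> = (\<Sum>\<alpha>\<in>J. c \<alpha> * (LINT x|M. h x * e \<alpha> x))"
      by (subst Bochner_Integration.integral_sum)
        (auto intro!: square_integrable_imp_integrable_mult[OF that] e2)
    finally show ?thesis .
  qed
  have fg: "(LINT x|M. f x * g x) = (\<Sum>\<alpha>\<in>J. (c \<alpha>)\<^sup>2)"
    by (simp add: inner_g[OF f] power2_eq_square flip: c_def)
  have eg: "(LINT x|M. e \<beta> x * g x) = c \<beta>" if "\<beta> \<in> J" for \<beta>
  proof -
    have "(LINT x|M. e \<beta> x * g x) = (\<Sum>\<alpha>\<in>J. if \<beta> = \<alpha> then c \<alpha> else 0)"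
      unfolding inner_g[OF e2[OF that]]
      using e that by (intro sum.cong) (auto simp: L2_orthonormal_def)
    with that J show ?thesis by simp
  qed
  have gg: "(LINT x|M. g x * g x) = (\<Sum>\<alpha>\<in>J. (c \<alpha>)\<^sup>2)"
    by (subst inner_g[OF g2]) (simp add: mult.commute[of "g _"] eg power2_eq_square)
  have "0 \<le> (LINT x|M. (f x - g x)\<^sup>2)"
    by simp
  also have "\<dots> = (LINT x|M. (f x)\<^sup>2 - 2 * (f x * g x) + g x * g x)"
    by (intro Bochner_Integration.integral_cong) (auto simp: power2_eq_square algebra_simps)
  also have "\<dots> = (LINT x|M. (f x)\<^sup>2) - (\<Sum>\<alpha>\<in>J. (c \<alpha>)\<^sup>2)"
    using f square_integrable_imp_integrable_mult[OF f g2] square_integrable_imp_integrable_mult[OF g2 g2]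
    by (simp add: fg gg square_integrable_def)
  finally show ?thesis
    by (simp add: c_def)
qed

text \<open>By \<open>2 a b \<le> a\<^sup>2 + b\<^sup>2\<close> and Bessel in each factor, a unit vector \<open>f \<otimes> g\<close> pairs with a
  partial isometry \<open>\<Sum>\<^sub>\<alpha> q\<^sub>\<alpha> \<otimes> p\<^sub>\<alpha>\<close> to at most \<open>1\<close>. This is the estimate behind the duality of the
  nuclear norm and the operator norm.\<close>

lemma orthonormal_pairing_le_one:
  assumes f: "square_integrable M f" "(LINT x|M. f x * f x) = 1"
    and g: "square_integrable N g" "(LINT x|N. g x * g x) = 1"
    and q: "L2_orthonormal M J q" and p: "L2_orthonormal N J p" and J: "finite J"
  shows "(\<Sum>\<alpha>\<in>J. (LINT x|M. f x * q \<alpha> x) * (LINT x|N. g x * p \<alpha> x)) \<le> 1"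
proof -
  let ?a = "\<lambda>\<alpha>. LINT x|M. f x * q \<alpha> x" and ?b = "\<lambda>\<alpha>. LINT x|N. g x * p \<alpha> x"
  have "2 * (\<Sum>\<alpha>\<in>J. ?a \<alpha> * ?b \<alpha>) \<le> (\<Sum>\<alpha>\<in>J. (?a \<alpha>)\<^sup>2) + (\<Sum>\<alpha>\<in>J. (?b \<alpha>)\<^sup>2)"
    unfolding sum_distrib_left sum.distrib[symmetric]
    by (intro sum_mono) (metis sum_squares_bound mult.assoc)
  moreover have "(\<Sum>\<alpha>\<in>J. (?a \<alpha>)\<^sup>2) \<le> 1" "(\<Sum>\<alpha>\<in>J. (?b \<alpha>)\<^sup>2) \<le> 1"
    using L2_orthonormal_Bessel[OF f(1) q J] L2_orthonormal_Bessel[OF g(1) p J] f(2) g(2)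
    by (simp_all add: power2_eq_square)
  ultimately show ?thesis by linarith
qed

section \<open>Splitting the product measure\<close>

lemma pos_bij: "bij_betw (pos :: 'n::{finite,linorder} \<Rightarrow> nat) UNIV {1..CARD('n)}"
proof -
  have mono: "pos i < pos j" if "i < j" for i j :: 'n
    unfolding pos_def using that by (intro psubset_card_mono) auto
  have inj: "inj (pos :: 'n \<Rightarrow> nat)"
    by (rule linorder_injI) (metis mono less_irrefl)
  have "pos j \<in> {1..CARD('n)}" for j :: 'n
    by (auto simp: pos_def Suc_le_eq card_gt_0_iff intro: card_mono)
  then have "pos ` (UNIV :: 'n set) = {1..CARD('n)}"
    by (intro card_subset_eq) (auto simp: card_image inj)
  with inj show ?thesis
    by (simp add: bij_betw_def)
qed

lemma pos_in: "pos (j :: 'n::{finite,linorder}) \<in> {1..CARD('n)}"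
  using bij_betwE[OF pos_bij[where 'n='n]] by blast

lemma pos_inv: "k \<in> {1..CARD('n)} \<Longrightarrow> pos (inv pos k :: 'n::{finite,linorder}) = k"
  by (metis bij_betw_imp_surj_on f_inv_into_f pos_bij)

lemma vars_vector:
  fixes y :: "nat \<Rightarrow> real"
  assumes "I \<subseteq> {1..CARD('n)}"
  shows "vars I (\<chi> j. y (pos j) :: real ^ 'n::{finite,linorder}) = restrict y I"
  using assms by (auto simp: vars_def restrict_def fun_eq_iff pos_inv subset_iff)

lemma integral_product_pair:
  fixes f :: "'a \<Rightarrow> real" and g :: "'b \<Rightarrow> real"
  assumes "sigma_finite_measure M" "sigma_finite_measure N"
    and f: "integrable M f" and g: "integrable N g"
  shows "integrable (M \<Otimes>\<^sub>M N) (\<lambda>(x, y). f x * g y)"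
    and "(LINT z|(M \<Otimes>\<^sub>M N). (case z of (x, y) \<Rightarrow> f x * g y)) = (LINT x|M. f x) * (LINT y|N. g y)"
proof -
  interpret M: sigma_finite_measure M by fact
  interpret N: sigma_finite_measure N by fact
  interpret pair_sigma_finite M N ..
  note [measurable] = borel_measurable_integrable[OF f] borel_measurable_integrable[OF g]
  show int: "integrable (M \<Otimes>\<^sub>M N) (\<lambda>(x, y). f x * g y)"
    by (rule Fubini_integrable) (use f g in \<open>simp_all add: abs_mult\<close>)
  show "(LINT z|(M \<Otimes>\<^sub>M N). (case z of (x, y) \<Rightarrow> f x * g y)) = (LINT x|M. f x) * (LINT y|N. g y)"
    using integral_fst[OF int] by simp
qed

text \<open>The parameter \<open>dim\<close> only carries the index type, hence the dimension \<open>CARD('n)\<close>.\<close>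

locale product_factors =
  fixes \<mu> :: "nat \<Rightarrow> real measure" and \<Omega> :: "nat \<Rightarrow> real set" and dim :: "'n::{finite,linorder} itself"
  assumes finite_factor: "\<And>k. k \<in> {1..CARD('n)} \<Longrightarrow> finite_measure (\<mu> k)"
    and sets_factor: "\<And>k. k \<in> {1..CARD('n)} \<Longrightarrow> sets (\<mu> k) = sets (restrict_space borel (\<Omega> k))"
begin

abbreviation "PM \<equiv> (product_measure \<mu> :: (real ^ 'n::{finite,linorder}) measure)"

lemma finite_measure_PiM_factors:
  assumes "I \<subseteq> {1..CARD('n)}"
  shows "finite_measure (Pi\<^sub>M I \<mu>)"
proof -
  \<comment> \<open>Replacing the factors outside \<open>I\<close> by null measures makes every factor sigma-finite
    and leaves the product over \<open>I\<close> unchanged.\<close>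
  define \<nu> where "\<nu> k = (if k \<in> I then \<mu> k else null_measure borel)" for k
  have fin: "finite_measure (\<nu> k)" for k
  proof (cases "k \<in> I")
    case True
    with assms have "finite_measure (\<mu> k)" by (intro finite_factor) blast
    with True show ?thesis by (simp add: \<nu>_def)
  qed (auto simp: \<nu>_def intro!: finite_measureI)
  interpret finite_measure "\<nu> k" for k by (rule fin)
  interpret product_sigma_finite \<nu> ..
  have I: "finite I" using assms finite_subset by blast
  have "emeasure (Pi\<^sub>M I \<nu>) (\<Pi>\<^sub>E k\<in>I. space (\<nu> k)) = (\<Prod>k\<in>I. emeasure (\<nu> k) (space (\<nu> k)))"
    by (rule emeasure_PiM[OF I]) auto
  also have "\<dots> \<noteq> \<infinity>"
    by (auto simp: ennreal_prod_eq_top emeasure_eq_measure)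
  finally have "finite_measure (Pi\<^sub>M I \<nu>)"
    by (intro finite_measureI) (simp add: space_PiM)
  moreover have "Pi\<^sub>M I \<nu> = Pi\<^sub>M I \<mu>"
    by (rule PiM_cong) (auto simp: \<nu>_def)
  ultimately show ?thesis by simp
qed

lemma distr_merge_factors:
  assumes "I \<union> J \<subseteq> {1..CARD('n)}" "I \<inter> J = {}"
  shows "distr (Pi\<^sub>M I \<mu> \<Otimes>\<^sub>M Pi\<^sub>M J \<mu>) (Pi\<^sub>M (I \<union> J) \<mu>) (merge I J) = Pi\<^sub>M (I \<union> J) \<mu>"
proof -
  define \<nu> where "\<nu> k = (if k \<in> I \<union> J then \<mu> k else null_measure borel)" for k
  have fin: "finite_measure (\<nu> k)" for k
  proof (cases "k \<in> I \<union> J")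
    case True
    with assms have "finite_measure (\<mu> k)" by (intro finite_factor) blast
    with True show ?thesis by (simp add: \<nu>_def)
  qed (auto simp: \<nu>_def intro!: finite_measureI)
  interpret finite_measure "\<nu> k" for k by (rule fin)
  interpret product_sigma_finite \<nu> ..
  have eq: "Pi\<^sub>M I \<nu> = Pi\<^sub>M I \<mu>" "Pi\<^sub>M J \<nu> = Pi\<^sub>M J \<mu>" "Pi\<^sub>M (I \<union> J) \<nu> = Pi\<^sub>M (I \<union> J) \<mu>"
    by (auto intro!: PiM_cong simp: \<nu>_def)
  have "finite I" "finite J"
    using assms(1) by (auto intro: finite_subset)
  from distr_merge[OF assms(2) this] show ?thesis
    by (simp add: eq)
qed

lemma space_factor: "k \<in> {1..CARD('n)} \<Longrightarrow> space (\<mu> k) = \<Omega> k"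
  using sets_eq_imp_space_eq[OF sets_factor[of k]] by (simp add: space_restrict_space)

lemma space_product_measure: "space PM = separable_domain \<Omega>"
proof -
  have "separable_domain (\<lambda>k. space (\<mu> k)) = (separable_domain \<Omega> :: (real ^ 'n::{finite,linorder}) set)"
    using pos_in[where 'n='n] by (auto simp: separable_domain_def space_factor)
  then show ?thesis
    by (simp add: product_measure_def space_restrict_space)
qed

lemma measurable_vector_of_factors:
  "(\<lambda>y. \<chi> j. y (pos j)) \<in> measurable (Pi\<^sub>M {1..CARD('n)} \<mu>)
      (restrict_space borel (separable_domain (\<lambda>k. space (\<mu> k))) :: (real ^ 'n::{finite,linorder}) measure)"
proof (rule measurable_restrict_space2)
  show "(\<lambda>y. \<chi> j. y (pos j)) \<in> space (Pi\<^sub>M {1..CARD('n)} \<mu>) \<rightarrow>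
      (separable_domain (\<lambda>k. space (\<mu> k)) :: (real ^ 'n::{finite,linorder}) set)"
    using pos_in[where 'n='n] by (auto simp: separable_domain_def space_PiM PiE_def Pi_def)
  have id: "(\<lambda>t. t) \<in> borel_measurable (\<mu> k)" if "k \<in> {1..CARD('n)}" for k
    by (subst measurable_cong_sets[OF sets_factor[OF that] refl])
      (simp add: measurable_restrict_space1)
  have comp: "(\<lambda>y. y (pos j)) \<in> borel_measurable (Pi\<^sub>M {1..CARD('n)} \<mu>)" for j :: 'n
  proof (rule measurable_compose)
    show "(\<lambda>y. y (pos j)) \<in> measurable (Pi\<^sub>M {1..CARD('n)} \<mu>) (\<mu> (pos j))"
      by (rule measurable_component_singleton) (rule pos_in)
  qed (rule id, rule pos_in)
  show "(\<lambda>y. \<chi> j. y (pos j) :: real ^ 'n::{finite,linorder}) \<in> borel_measurable (Pi\<^sub>M {1..CARD('n)} \<mu>)"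
    by (rule iffD2[OF borel_measurable_euclidean_space])
      (auto simp: Basis_vec_def inner_axis comp simp del: One_nat_def)
qed

lemma measurable_vars:
  assumes "I \<subseteq> {1..CARD('n)}"
  shows "vars I \<in> measurable PM (Pi\<^sub>M I \<mu>)"
proof -
  have "(\<lambda>x :: real ^ 'n::{finite,linorder}. x $ inv pos k) \<in> measurable PM (\<mu> k)" if "k \<in> I" for k
  proof -
    have k: "k \<in> {1..CARD('n)}" using that assms by blast
    have "(\<lambda>x :: real ^ 'n::{finite,linorder}. x $ inv pos k) \<in> measurable PM (restrict_space borel (\<Omega> k))"
    proof (rule measurable_restrict_space2)
      show "(\<lambda>x :: real ^ 'n::{finite,linorder}. x $ inv pos k) \<in> space PM \<rightarrow> \<Omega> k"
      proof
        fix x :: "real ^ 'n::{finite,linorder}" assume "x \<in> space PM"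
        then have "x $ inv pos k \<in> \<Omega> (pos (inv pos k :: 'n))"
          by (auto simp: space_product_measure separable_domain_def)
        then show "x $ inv pos k \<in> \<Omega> k"
          by (simp only: pos_inv[OF k])
      qed
      have "(\<lambda>x :: real ^ 'n::{finite,linorder}. x $ inv pos k) \<in> borel_measurable borel"
        by (intro borel_measurable_continuous_onI continuous_intros)
      then show "(\<lambda>x :: real ^ 'n::{finite,linorder}. x $ inv pos k) \<in> borel_measurable PM"
        by (simp add: product_measure_def measurable_restrict_space1)
    qed
    then show ?thesis
      by (subst measurable_cong_sets[OF refl sets_factor[OF k]])
  qed
  then show ?thesis
    unfolding vars_def[abs_def] by (rule measurable_restrict)
qed

text \<open>In terms of the variables \<open>(x\<^bsub>\<le>i\<^esub>, x\<^bsub>>i\<^esub>)\<close> the measure on the domain is the product of \<open>\<mu>\<^bsub>\<le>i\<^esub>\<close> and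
  \<open>\<mu>\<^bsub>>i\<^esub>\<close>. Both sides are images of the same product: restricting a merged pair to \<open>I\<close> and to \<open>J\<close>
  gives back the pair.\<close>

lemma distr_vars_split:
  assumes i: "i \<in> {1..<CARD('n)}"
  defines "I \<equiv> {1..i}" and "J \<equiv> {i<..CARD('n)}"
  shows "distr PM (Pi\<^sub>M I \<mu> \<Otimes>\<^sub>M Pi\<^sub>M J \<mu>) (\<lambda>x. (vars I x, vars J x)) = Pi\<^sub>M I \<mu> \<Otimes>\<^sub>M Pi\<^sub>M J \<mu>"
proof -
  let ?P = "Pi\<^sub>M I \<mu> \<Otimes>\<^sub>M Pi\<^sub>M J \<mu>" and ?d = "{1..CARD('n)}"
  have IJ: "I \<union> J = ?d" "I \<inter> J = {}" "I \<subseteq> ?d" "J \<subseteq> ?d"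
    using i by (auto simp: I_def J_def)
  have split: "(\<lambda>x. (vars I x, vars J x)) \<in> measurable PM ?P"
    by (intro measurable_Pair measurable_vars IJ)
  have restr: "(\<lambda>y. (restrict y I, restrict y J)) \<in> measurable (Pi\<^sub>M ?d \<mu>) ?P"
    by (intro measurable_Pair measurable_restrict_subset IJ)
  have merge: "distr ?P (Pi\<^sub>M ?d \<mu>) (merge I J) = Pi\<^sub>M ?d \<mu>"
    using distr_merge_factors[of I J] IJ by simp
  have mm: "merge I J \<in> measurable ?P (Pi\<^sub>M ?d \<mu>)"
    using measurable_merge[of I J \<mu>] IJ by simp
  have "distr PM ?P (\<lambda>x. (vars I x, vars J x))
      = distr (Pi\<^sub>M ?d \<mu>) ?P ((\<lambda>x. (vars I x, vars J x)) \<circ> (\<lambda>y. \<chi> j. y (pos j) :: real ^ 'n::{finite,linorder}))"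
    unfolding product_measure_def
    by (rule distr_distr[OF _ measurable_vector_of_factors])
      (use split in \<open>simp add: product_measure_def\<close>)
  also have "\<dots> = distr (Pi\<^sub>M ?d \<mu>) ?P (\<lambda>y. (restrict y I, restrict y J))"
    using IJ by (simp add: comp_def vars_vector)
  also have "\<dots> = distr (distr ?P (Pi\<^sub>M ?d \<mu>) (merge I J)) ?P (\<lambda>y. (restrict y I, restrict y J))"
    by (simp only: merge)
  also have "\<dots> = distr ?P ?P ((\<lambda>y. (restrict y I, restrict y J)) \<circ> merge I J)"
    by (rule distr_distr[OF restr mm])
  also have "\<dots> = distr ?P ?P (\<lambda>z. z)"
    by (rule distr_cong)
      (use IJ in \<open>auto simp: space_pair_measure space_PiM PiE_def\<close>)
  also have "\<dots> = ?P"
    by (simp add: distr_id)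
  finally show ?thesis .
qed

lemma integral_separated:
  assumes i: "i \<in> {1..<CARD('n)}"
    and q: "integrable (Pi\<^sub>M {1..i} \<mu>) q" and p: "integrable (Pi\<^sub>M {i<..CARD('n)} \<mu>) p"
  shows "integrable PM (\<lambda>x. q (vars {1..i} x) * p (vars {i<..CARD('n)} x) :: real)" (is ?int)
    and "(LINT x|PM. q (vars {1..i} x) * p (vars {i<..CARD('n)} x))
      = (LINT y|Pi\<^sub>M {1..i} \<mu>. q y) * (LINT z|Pi\<^sub>M {i<..CARD('n)} \<mu>. p z)" (is ?eq)
proof -
  let ?I = "Pi\<^sub>M {1..i} \<mu>" and ?J = "Pi\<^sub>M {i<..CARD('n)} \<mu>"
  let ?s = "\<lambda>x :: real ^ 'n::{finite,linorder}. (vars {1..i} x, vars {i<..CARD('n)} x)"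
  have IJ: "{1..i} \<subseteq> {1..CARD('n)}" "{i<..CARD('n)} \<subseteq> {1..CARD('n)}"
    using i by auto
  interpret I: finite_measure ?I by (rule finite_measure_PiM_factors) (fact IJ)
  interpret J: finite_measure ?J by (rule finite_measure_PiM_factors) (fact IJ)
  have split: "?s \<in> measurable PM (?I \<Otimes>\<^sub>M ?J)"
    by (intro measurable_Pair measurable_vars IJ)
  note pair = integral_product_pair[OF I.sigma_finite_measure_axioms J.sigma_finite_measure_axioms q p]
  have "integrable (distr PM (?I \<Otimes>\<^sub>M ?J) ?s) (\<lambda>(y, z). q y * p z)"
    by (simp only: distr_vars_split[OF i] pair)
  from integrable_distr[OF split this] show ?int
    by simp
  have "(LINT x|PM. q (vars {1..i} x) * p (vars {i<..CARD('n)} x))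
      = (LINT w|distr PM (?I \<Otimes>\<^sub>M ?J) ?s. (case w of (y, z) \<Rightarrow> q y * p z))"
    by (subst integral_distr[OF split]) (use pair(1) in auto)
  also have "\<dots> = (LINT y|?I. q y) * (LINT z|?J. p z)"
    by (simp only: distr_vars_split[OF i] pair)
  finally show ?eq .
qed

lemma integral_separated_L2:
  assumes i: "i \<in> {1..<CARD('n)}"
    and q: "square_integrable (Pi\<^sub>M {1..i} \<mu>) q" "square_integrable (Pi\<^sub>M {1..i} \<mu>) q'"
    and p: "square_integrable (Pi\<^sub>M {i<..CARD('n)} \<mu>) p" "square_integrable (Pi\<^sub>M {i<..CARD('n)} \<mu>) p'"
  shows "(LINT x|PM. (q (vars {1..i} x) * p (vars {i<..CARD('n)} x)) *
        (q' (vars {1..i} x) * p' (vars {i<..CARD('n)} x)))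
      = (LINT y|Pi\<^sub>M {1..i} \<mu>. q y * q' y) * (LINT z|Pi\<^sub>M {i<..CARD('n)} \<mu>. p z * p' z)"
  using integral_separated(2)[OF i square_integrable_imp_integrable_mult[OF q]
      square_integrable_imp_integrable_mult[OF p]]
  by (simp add: mult_ac)

lemma square_integrable_separated:
  assumes i: "i \<in> {1..<CARD('n)}"
    and q: "square_integrable (Pi\<^sub>M {1..i} \<mu>) q" and p: "square_integrable (Pi\<^sub>M {i<..CARD('n)} \<mu>) p"
  shows "square_integrable PM (\<lambda>x. q (vars {1..i} x) * p (vars {i<..CARD('n)} x))"
proof -
  have IJ: "{1..i} \<subseteq> {1..CARD('n)}" "{i<..CARD('n)} \<subseteq> {1..CARD('n)}"
    using i by auto
  have "(\<lambda>x. q (vars {1..i} x)) \<in> borel_measurable PM"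
    using measurable_compose[OF measurable_vars[OF IJ(1)]] q by (auto simp: square_integrable_def)
  moreover have "(\<lambda>x. p (vars {i<..CARD('n)} x)) \<in> borel_measurable PM"
    using measurable_compose[OF measurable_vars[OF IJ(2)]] p by (auto simp: square_integrable_def)
  ultimately show ?thesis
    using integral_separated(1)[OF i, of "\<lambda>y. (q y)\<^sup>2" "\<lambda>z. (p z)\<^sup>2"] q p
    by (simp add: square_integrable_def power_mult_distrib)
qed

section \<open>Duality for the sum of the singular values\<close>

text \<open>\<open>\<Sum>\<^sub>\<alpha> c\<^sub>\<alpha> (q\<^sub>\<alpha> \<otimes> p\<^sub>\<alpha>)\<close> for the splitting after the \<open>i\<close>-th variable: a truncated singular value expansion
  when \<open>c\<close> consists of singular values, a partial isometry when \<open>c = 1\<close> and both families are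
  orthonormal.\<close>

definition separated_sum ::
    "nat \<Rightarrow> nat set \<Rightarrow> (nat \<Rightarrow> real) \<Rightarrow> (nat \<Rightarrow> (nat \<Rightarrow> real) \<Rightarrow> real) \<Rightarrow> (nat \<Rightarrow> (nat \<Rightarrow> real) \<Rightarrow> real) \<Rightarrow>
     real ^ 'n::{finite,linorder} \<Rightarrow> real"
  where "separated_sum i K c q p x = (\<Sum>\<alpha>\<in>K. q \<alpha> (vars {1..i} x) * c \<alpha> * p \<alpha> (vars {i<..CARD('n)} x))"

lemma square_integrable_separated_sum:
  assumes i: "i \<in> {1..<CARD('n)}"
    and q: "L2_orthonormal (Pi\<^sub>M {1..i} \<mu>) K q" and p: "L2_orthonormal (Pi\<^sub>M {i<..CARD('n)} \<mu>) K p"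
  shows "square_integrable PM (separated_sum i K c q p)"
proof -
  have "square_integrable PM (\<lambda>x. \<Sum>\<alpha>\<in>K. c \<alpha> * (q \<alpha> (vars {1..i} x) * p \<alpha> (vars {i<..CARD('n)} x)))"
    using q p by (intro square_integrable_sum square_integrable_scale square_integrable_separated[OF i])
      (auto simp: L2_orthonormal_def)
  then show ?thesis
    by (simp add: separated_sum_def[abs_def] mult_ac)
qed

lemma inner_separated_sums:
  assumes i: "i \<in> {1..<CARD('n)}"
    and q: "L2_orthonormal (Pi\<^sub>M {1..i} \<mu>) K q" and p: "L2_orthonormal (Pi\<^sub>M {i<..CARD('n)} \<mu>) K p"
    and q': "L2_orthonormal (Pi\<^sub>M {1..i} \<mu>) J q'" and p': "L2_orthonormal (Pi\<^sub>M {i<..CARD('n)} \<mu>) J p'"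
  shows "(LINT x|PM. separated_sum i K c q p x * separated_sum i J c' q' p' x)
    = (\<Sum>\<beta>\<in>K. c \<beta> * (\<Sum>\<alpha>\<in>J. c' \<alpha> * ((LINT y|Pi\<^sub>M {1..i} \<mu>. q \<beta> y * q' \<alpha> y) * (LINT z|Pi\<^sub>M {i<..CARD('n)} \<mu>. p \<beta> z * p' \<alpha> z))))"
proof -
  let ?t = "\<lambda>q p \<alpha> x. q \<alpha> (vars {1..i} x) * p \<alpha> (vars {i<..CARD('n)} x)"
  have int: "integrable PM (\<lambda>x. ?t q p \<beta> x * ?t q' p' \<alpha> x)" if "\<beta> \<in> K" "\<alpha> \<in> J" for \<beta> \<alpha>
    using q p q' p' that
    by (intro square_integrable_imp_integrable_mult square_integrable_separated[OF i])
      (auto simp: L2_orthonormal_def)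
  have "(LINT x|PM. separated_sum i K c q p x * separated_sum i J c' q' p' x)
      = (LINT x|PM. (\<Sum>\<beta>\<in>K. \<Sum>\<alpha>\<in>J. c \<beta> * (c' \<alpha> * (?t q p \<beta> x * ?t q' p' \<alpha> x))))"
    by (simp add: separated_sum_def sum_product mult_ac)
  also have "\<dots> = (\<Sum>\<beta>\<in>K. \<Sum>\<alpha>\<in>J. c \<beta> * (c' \<alpha> * (LINT x|PM. ?t q p \<beta> x * ?t q' p' \<alpha> x)))"
    by (simp add: Bochner_Integration.integral_sum Bochner_Integration.integrable_sum int
        del: One_nat_def)
  also have "\<dots> = (\<Sum>\<beta>\<in>K. \<Sum>\<alpha>\<in>J. c \<beta> * (c' \<alpha> *
      ((LINT y|Pi\<^sub>M {1..i} \<mu>. q \<beta> y * q' \<alpha> y) * (LINT z|Pi\<^sub>M {i<..CARD('n)} \<mu>. p \<beta> z * p' \<alpha> z))))"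
    using q p q' p' by (intro sum.cong refl) (subst integral_separated_L2[OF i], auto simp: L2_orthonormal_def)
  finally show ?thesis
    by (simp add: sum_distrib_left)
qed

lemma singular_system_inner_tendsto:
  fixes f :: "real ^ 'n::{finite,linorder} \<Rightarrow> real"
  assumes i: "i \<in> {1..<CARD('n)}"
    and sys: "singular_system \<mu> i f r \<sigma> q p" and h: "square_integrable PM h"
  shows "(\<lambda>n. LINT x|PM. separated_sum i (rank_indices r \<inter> {..n}) \<sigma> q p x * h x)
    \<longlonglongrightarrow> (LINT x|PM. f x * h x)"
proof (rule L2_inner_continuous[OF h])
  show "square_integrable PM f"
    using sys by (simp add: singular_system_def)
  show "\<forall>\<^sub>F n in sequentially. square_integrable PM (separated_sum i (rank_indices r \<inter> {..n}) \<sigma> q p)"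
    using sys by (intro always_eventually allI square_integrable_separated_sum[OF i])
      (auto simp: singular_system_def intro: L2_orthonormal_subset)
  have "L2norm PM (\<lambda>x. separated_sum i K \<sigma> q p x - f x) = L2norm PM (\<lambda>x. f x - separated_sum i K \<sigma> q p x)" for K
    by (simp add: L2norm_def power2_commute)
  then show "(\<lambda>n. L2norm PM (\<lambda>x. separated_sum i (rank_indices r \<inter> {..n}) \<sigma> q p x - f x)) \<longlonglongrightarrow> 0"
    using sys by (simp add: singular_system_def separated_sum_def)
qed

text \<open>The easy half of nuclear norm duality. A truncated expansion of \<open>f\<close> is \<open>\<Sum> \<sigma>\<^sub>\<beta> (q\<^sub>\<beta> \<otimes> p\<^sub>\<beta>)\<close> with
  \<open>\<sigma>\<^sub>\<beta> \<ge> 0\<close>, and each \<open>q\<^sub>\<beta> \<otimes> p\<^sub>\<beta>\<close> pairs with the partial isometry to at most \<open>1\<close>; the bound survives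
  the \<open>L\<^sup>2\<close> limit.\<close>

lemma pairing_le_singular_value_sum:
  fixes f :: "real ^ 'n::{finite,linorder} \<Rightarrow> real"
  assumes i: "i \<in> {1..<CARD('n)}"
    and sum: "has_singular_value_sum \<mu> i f s"
    and q': "L2_orthonormal (Pi\<^sub>M {1..i} \<mu>) J q'" and p': "L2_orthonormal (Pi\<^sub>M {i<..CARD('n)} \<mu>) J p'" and J: "finite J"
  shows "(LINT x|PM. f x * separated_sum i J (\<lambda>_. 1) q' p' x) \<le> s"
proof -
  from sum obtain r \<sigma> q p where sys: "singular_system \<mu> i f r \<sigma> q p"
    and s: "(\<sigma> has_sum s) (rank_indices r)"
    by (auto simp: has_singular_value_sum_def)
  have nonneg: "0 \<le> \<sigma> \<beta>" if "\<beta> \<in> rank_indices r" for \<beta>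
    using sys that by (simp add: singular_system_def)
  have q: "L2_orthonormal (Pi\<^sub>M {1..i} \<mu>) (rank_indices r) q" and p: "L2_orthonormal (Pi\<^sub>M {i<..CARD('n)} \<mu>) (rank_indices r) p"
    using sys by (auto simp: singular_system_def)
  have bound: "(LINT x|PM. separated_sum i (rank_indices r \<inter> {..n}) \<sigma> q p x *
      separated_sum i J (\<lambda>_. 1) q' p' x) \<le> s" for n
  proof -
    let ?K = "rank_indices r \<inter> {..n}"
    have "(LINT x|PM. separated_sum i ?K \<sigma> q p x * separated_sum i J (\<lambda>_. 1) q' p' x)
        = (\<Sum>\<beta>\<in>?K. \<sigma> \<beta> * (\<Sum>\<alpha>\<in>J. 1 * ((LINT y|Pi\<^sub>M {1..i} \<mu>. q \<beta> y * q' \<alpha> y) * (LINT z|Pi\<^sub>M {i<..CARD('n)} \<mu>. p \<beta> z * p' \<alpha> z))))"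
      by (intro inner_separated_sums i q' p' L2_orthonormal_subset[OF q] L2_orthonormal_subset[OF p]) auto
    also have "\<dots> \<le> (\<Sum>\<beta>\<in>?K. \<sigma> \<beta> * 1)"
    proof (intro sum_mono mult_left_mono)
      fix \<beta> assume \<beta>: "\<beta> \<in> ?K"
      show "(\<Sum>\<alpha>\<in>J. 1 * ((LINT y|Pi\<^sub>M {1..i} \<mu>. q \<beta> y * q' \<alpha> y) * (LINT z|Pi\<^sub>M {i<..CARD('n)} \<mu>. p \<beta> z * p' \<alpha> z))) \<le> 1"
        unfolding mult_1_left
        using q p \<beta> by (intro orthonormal_pairing_le_one q' p' J) (auto simp: L2_orthonormal_def)
    qed (use nonneg in auto)
    also have "\<dots> \<le> s"
      using finite_sum_le_has_sum[OF s, of ?K] nonneg by simp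
    finally show ?thesis .
  qed
  show ?thesis
    by (rule LIMSEQ_le_const2[OF singular_system_inner_tendsto[OF i sys square_integrable_separated_sum[OF i q' p']]])
      (use bound in blast)
qed

text \<open>The bound is attained at the partial isometry built from the singular functions of \<open>f\<close> itself,
  since orthonormality leaves only the diagonal terms.\<close>

lemma pairing_with_own_singular_functions:
  fixes f :: "real ^ 'n::{finite,linorder} \<Rightarrow> real"
  assumes i: "i \<in> {1..<CARD('n)}"
    and sys: "singular_system \<mu> i f r \<sigma> q p" and J: "finite J" "J \<subseteq> rank_indices r"
  shows "(LINT x|PM. f x * separated_sum i J (\<lambda>_. 1) q p x) = (\<Sum>\<alpha>\<in>J. \<sigma> \<alpha>)"
proof -
  have q: "L2_orthonormal (Pi\<^sub>M {1..i} \<mu>) (rank_indices r) q" and p: "L2_orthonormal (Pi\<^sub>M {i<..CARD('n)} \<mu>) (rank_indices r) p"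
    using sys by (auto simp: singular_system_def)
  note qJ = L2_orthonormal_subset[OF q J(2)] and pJ = L2_orthonormal_subset[OF p J(2)]
  have "(LINT x|PM. separated_sum i (rank_indices r \<inter> {..n}) \<sigma> q p x * separated_sum i J (\<lambda>_. 1) q p x)
      = (\<Sum>\<alpha>\<in>J. \<sigma> \<alpha>)" if "Max (insert 0 J) \<le> n" for n
  proof -
    \<comment> \<open>Once the truncation contains \<open>J\<close>, the pairing no longer changes with \<open>n\<close>.\<close>
    let ?K = "rank_indices r \<inter> {..n}"
    have JK: "J \<subseteq> ?K"
      using J that by auto
    have "(LINT x|PM. separated_sum i ?K \<sigma> q p x * separated_sum i J (\<lambda>_. 1) q p x)
        = (\<Sum>\<beta>\<in>?K. \<sigma> \<beta> * (\<Sum>\<alpha>\<in>J. 1 * ((LINT y|Pi\<^sub>M {1..i} \<mu>. q \<beta> y * q \<alpha> y) * (LINT z|Pi\<^sub>M {i<..CARD('n)} \<mu>. p \<beta> z * p \<alpha> z))))"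
      by (intro inner_separated_sums i qJ pJ L2_orthonormal_subset[OF q] L2_orthonormal_subset[OF p]) auto
    also have "\<dots> = (\<Sum>\<beta>\<in>?K. \<sigma> \<beta> * (\<Sum>\<alpha>\<in>J. if \<beta> = \<alpha> then 1 else 0))"
    proof (intro sum.cong refl arg_cong2[where f="(*)"])
      fix \<beta> \<alpha> assume "\<beta> \<in> ?K" "\<alpha> \<in> J"
      then show "1 * ((LINT y|Pi\<^sub>M {1..i} \<mu>. q \<beta> y * q \<alpha> y) * (LINT z|Pi\<^sub>M {i<..CARD('n)} \<mu>. p \<beta> z * p \<alpha> z)) = (if \<beta> = \<alpha> then 1 else 0)"
        using q p J(2) unfolding L2_orthonormal_def by (auto simp: subset_iff)
    qed
    also have "\<dots> = (\<Sum>\<beta>\<in>?K. if \<beta> \<in> J then \<sigma> \<beta> else 0)"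
      using J(1) by (intro sum.cong) auto
    also have "\<dots> = (\<Sum>\<beta>\<in>J. \<sigma> \<beta>)"
      using JK by (simp flip: sum.inter_restrict add: Int_absorb1)
    finally show ?thesis .
  qed
  then have "(\<lambda>n. LINT x|PM. separated_sum i (rank_indices r \<inter> {..n}) \<sigma> q p x *
      separated_sum i J (\<lambda>_. 1) q p x) \<longlonglongrightarrow> (\<Sum>\<alpha>\<in>J. \<sigma> \<alpha>)"
    by (intro tendsto_eventually eventually_sequentiallyI)
  then show ?thesis
    using singular_system_inner_tendsto[OF i sys square_integrable_separated_sum[OF i qJ pJ]]
    by (rule LIMSEQ_unique[symmetric])
qed

text \<open>Two singular systems of \<open>f\<close> have the same sum because, by duality, each sum bounds the finite partial
  sums of the other one. Hence the definite description in \<open>S_cost\<close> denotes this sum.\<close>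

lemma singular_value_sum_unique:
  fixes f :: "real ^ 'n::{finite,linorder} \<Rightarrow> real"
  assumes i: "i \<in> {1..<CARD('n)}"
    and s: "has_singular_value_sum \<mu> i f s" and s': "has_singular_value_sum \<mu> i f s'"
  shows "s = s'"
proof -
  have "t' \<le> t" if t: "has_singular_value_sum \<mu> i f t" and t': "has_singular_value_sum \<mu> i f t'" for t t'
  proof -
    from t' obtain r \<sigma> q p where sys: "singular_system \<mu> i f r \<sigma> q p"
      and sum: "(\<sigma> has_sum t') (rank_indices r)"
      by (auto simp: has_singular_value_sum_def)
    have "(\<Sum>\<alpha>\<in>J. \<sigma> \<alpha>) \<le> t" if J: "finite J" "J \<subseteq> rank_indices r" for J
    proof -
      have "L2_orthonormal (Pi\<^sub>M {1..i} \<mu>) J q" "L2_orthonormal (Pi\<^sub>M {i<..CARD('n)} \<mu>) J p"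
        using sys by (auto simp: singular_system_def intro: L2_orthonormal_subset[OF _ J(2)])
      from pairing_le_singular_value_sum[OF i t this J(1)] show ?thesis
        by (simp only: pairing_with_own_singular_functions[OF i sys J])
    qed
    then have "\<forall>\<^sub>F J in finite_subsets_at_top (rank_indices r). (\<Sum>\<alpha>\<in>J. \<sigma> \<alpha>) \<le> t"
      by (intro eventually_finite_subsets_at_top_weakI)
    then show ?thesis
      by (rule tendsto_upperbound[OF sum[unfolded has_sum_def]]) simp
  qed
  from this[OF s s'] this[OF s' s] show ?thesis by (rule order.antisym[rotated])
qed

lemma S_cost_eq:
  fixes f :: "real ^ 'n::{finite,linorder} \<Rightarrow> real"
  assumes "\<And>i. i \<in> {1..<CARD('n)} \<Longrightarrow> has_singular_value_sum \<mu> i f (s i)"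
  shows "S_cost \<mu> f = (\<Sum>i\<in>{1..<CARD('n)}. s i)"
  unfolding S_cost_def
proof (intro sum.cong refl the_equality)
  fix i t assume i: "i \<in> {1..<CARD('n)}"
  show "has_singular_value_sum \<mu> i f (s i)"
    by (rule assms[OF i])
  assume "has_singular_value_sum \<mu> i f t"
  then show "t = s i"
    using assms[OF i] by (rule singular_value_sum_unique[OF i])
qed

lemma pairing_le_S_cost:
  fixes f :: "real ^ 'n::{finite,linorder} \<Rightarrow> real"
  assumes "\<And>i. i \<in> {1..<CARD('n)} \<Longrightarrow> \<exists>s. has_singular_value_sum \<mu> i f s"
    and "\<And>i. i \<in> {1..<CARD('n)} \<Longrightarrow> L2_orthonormal (Pi\<^sub>M {1..i} \<mu>) {1..r i} (q i)"
    and "\<And>i. i \<in> {1..<CARD('n)} \<Longrightarrow> L2_orthonormal (Pi\<^sub>M {i<..CARD('n)} \<mu>) {1..r i} (p i)"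
  shows "(\<Sum>i\<in>{1..<CARD('n)}. LINT x|PM. f x * separated_sum i {1..r i} (\<lambda>_. 1) (q i) (p i) x) \<le> S_cost \<mu> f"
proof -
  from assms(1) obtain s where s: "\<And>i. i \<in> {1..<CARD('n)} \<Longrightarrow> has_singular_value_sum \<mu> i f (s i)"
    by metis
  have "S_cost \<mu> f = (\<Sum>i\<in>{1..<CARD('n)}. s i)"
    by (rule S_cost_eq) (rule s)
  moreover have "(LINT x|PM. f x * separated_sum i {1..r i} (\<lambda>_. 1) (q i) (p i) x) \<le> s i"
    if i: "i \<in> {1..<CARD('n)}" for i
    by (rule pairing_le_singular_value_sum[OF i s[OF i] assms(2)[OF i] assms(3)[OF i]]) simp
  ultimately show ?thesis
    by (simp only: sum_mono)
qed

lemma orthogonalized_FTT_singular_system: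
  fixes f :: "real ^ 'n::{finite,linorder} \<Rightarrow> real"
  assumes i: "i \<in> {1..<CARD('n)}"
    and f: "square_integrable PM f" and orth: "orthogonalized_FTT \<mu> i f r Q \<sigma>"
  shows "singular_system \<mu> i f (enat (r i)) \<sigma> (Q_le r Q i) (Q_gt r Q CARD('n) i)"
proof -
  have R: "rank_indices (enat (r i)) = {1..r i}"
    by (auto simp: rank_indices_def)
  let ?F = "\<lambda>n. separated_sum i ({1..r i} \<inter> {..n}) \<sigma> (Q_le r Q i) (Q_gt r Q CARD('n) i)"
  have "L2norm PM (\<lambda>x. f x - ?F n x) = 0" if "r i \<le> n" for n
  proof -
    have K: "{1..r i} \<inter> {..n} = {1..r i}" using that by auto
    have "AE x in PM. f x =
        separated_sum i {1..r i} \<sigma> (Q_le r Q i) (Q_gt r Q CARD('n) i) x"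
      using orth unfolding orthogonalized_FTT_def separated_sum_def by blast
    then have "AE x in PM. (f x - ?F n x)\<^sup>2 = 0"
      unfolding K by eventually_elim simp
    then have "(LINT x|PM. (f x - ?F n x)\<^sup>2) = 0"
      by (rule integral_eq_zero_AE)
    then show ?thesis by (simp add: L2norm_def)
  qed
  then have "(\<lambda>n. L2norm PM (\<lambda>x. f x - ?F n x)) \<longlonglongrightarrow> 0"
    by (intro tendsto_eventually eventually_sequentiallyI)
  with f orth show ?thesis
    unfolding singular_system_def R by (auto simp: orthogonalized_FTT_def separated_sum_def)
qed

text \<open>A finite orthogonalization is a singular system of finite rank, so \<open>S(f)\<close> is the pairing of \<open>f\<close> with
  the partial isometries \<open>Q\<^bsub>\<le>i\<^esub> Q\<^bsub>>i\<^esub>\<close>. A term with \<open>\<sigma>\<^sub>i(\<alpha>) = 0\<close> is kept in the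
  partial isometry and pairs with \<open>f\<close> to \<open>0\<close>.\<close>

lemma S_cost_orthogonalized_FTT:
  fixes f :: "real ^ 'n::{finite,linorder} \<Rightarrow> real"
  assumes f: "square_integrable PM f"
    and orth: "\<And>i. i \<in> {1..<CARD('n)} \<Longrightarrow> orthogonalized_FTT \<mu> i f r (Q i) (\<sigma> i)"
  shows "S_cost \<mu> f = (\<Sum>i\<in>{1..<CARD('n)}. LINT x|PM. f x *
      separated_sum i {1..r i} (\<lambda>_. 1) (Q_le r (Q i) i) (Q_gt r (Q i) CARD('n) i) x)"
proof (rule S_cost_eq)
  fix i assume i: "i \<in> {1..<CARD('n)}"
  have R: "rank_indices (enat (r i)) = {1..r i}"
    by (auto simp: rank_indices_def)
  note sys = orthogonalized_FTT_singular_system[OF i f orth[OF i]]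
  have "(LINT x|PM. f x * separated_sum i {1..r i} (\<lambda>_. 1) (Q_le r (Q i) i) (Q_gt r (Q i) CARD('n) i) x)
      = (\<Sum>\<alpha>=1..r i. \<sigma> i \<alpha>)"
    by (rule pairing_with_own_singular_functions[OF i sys]) (auto simp: R)
  moreover have "(\<sigma> i has_sum (\<Sum>\<alpha>=1..r i. \<sigma> i \<alpha>)) (rank_indices (enat (r i)))"
    by (simp add: R)
  ultimately show "has_singular_value_sum \<mu> i f (LINT x|PM. f x *
      separated_sum i {1..r i} (\<lambda>_. 1) (Q_le r (Q i) i) (Q_gt r (Q i) CARD('n) i) x)"
    using sys by (auto simp: has_singular_value_sum_def)
qed

end

section \<open>Straight lines in the special linear group\<close>

text \<open>
  Uniqueness of the gradient and integrability of the integrand of \<open>D\<close> both need curves in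
  \<open>SL\<^sub>d\<close> in enough directions to span the traceless matrices. Matrices \<open>N\<close> with \<open>N\<^sup>2 = 0\<close> suffice, and
  for them the straight line \<open>(I + t N) A\<close> stays in the group.
\<close>

lemma bounded_bilinear_matrix_mult:
  "bounded_bilinear ((**) :: real ^ 'n ^ 'm \<Rightarrow> real ^ 'p ^ 'n \<Rightarrow> real ^ 'p ^ 'm)"
  unfolding bilinear_conv_bounded_bilinear[symmetric] bilinear_def
  by (intro conjI allI linearI)
    (simp_all add: vec_eq_iff matrix_matrix_mult_def algebra_simps sum.distrib sum_distrib_left)

lemmas matrix_mult_linear =
  bounded_bilinear.add_left[OF bounded_bilinear_matrix_mult]
  bounded_bilinear.add_right[OF bounded_bilinear_matrix_mult]
  bounded_bilinear.diff_left[OF bounded_bilinear_matrix_mult]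
  bounded_bilinear.diff_right[OF bounded_bilinear_matrix_mult]
  bounded_bilinear.scaleR_left[OF bounded_bilinear_matrix_mult]
  bounded_bilinear.scaleR_right[OF bounded_bilinear_matrix_mult]

definition unit_matrix :: "'n \<Rightarrow> 'n \<Rightarrow> real ^ 'n ^ 'n"
  where "unit_matrix i j = axis i (axis j 1)"

text \<open>The rank one matrix \<open>(e\<^sub>i + e\<^sub>j) (e\<^sub>j - e\<^sub>i)\<^sup>T\<close>, which squares to \<open>0\<close> for \<open>i \<noteq> j\<close>. It supplies the diagonal
  directions that the off-diagonal unit matrices miss.\<close>

definition diagonal_direction :: "'n \<Rightarrow> 'n \<Rightarrow> real ^ 'n ^ 'n"
  where "diagonal_direction i j =
    unit_matrix i j + unit_matrix j j - unit_matrix i i - unit_matrix j i"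

definition line_direction :: "real ^ 'n ^ 'n \<Rightarrow> bool"
  where "line_direction N \<longleftrightarrow> (\<forall>t. det (mat 1 + t *\<^sub>R N) = 1)"

definition frobenius :: "real ^ 'n ^ 'n \<Rightarrow> real ^ 'n ^ 'n \<Rightarrow> real"
  where "frobenius D N = (\<Sum>i\<in>UNIV. \<Sum>j\<in>UNIV. D $ i $ j * N $ i $ j)"

lemma unit_matrix_nth: "unit_matrix i j $ k $ l = (if k = i \<and> l = j then 1 else 0)"
  by (simp add: unit_matrix_def axis_def)

lemma unit_matrix_mult: "unit_matrix i j ** unit_matrix k l = (if j = k then unit_matrix i l else 0)"
proof -
  have "(\<Sum>m\<in>UNIV. (if a = i \<and> m = j then 1 else 0) * (if m = k \<and> b = l then 1 else 0 :: real))
      = (\<Sum>m\<in>UNIV. if m = j then (if a = i \<and> j = k \<and> b = l then 1 else 0) else 0)" for a b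
    by (intro sum.cong) auto
  then show ?thesis
    by (simp add: vec_eq_iff matrix_matrix_mult_def unit_matrix_nth)
qed

lemma det_conjugate_line:
  fixes N P P' :: "real ^ 'n ^ 'n"
  assumes inv: "P ** P' = mat 1"
  shows "det (mat 1 + t *\<^sub>R (P ** N ** P')) = det (mat 1 + t *\<^sub>R N)"
proof -
  have "mat 1 + t *\<^sub>R (P ** N ** P') = P ** (mat 1 + t *\<^sub>R N) ** P'"
    by (simp add: matrix_mult_linear inv)
  moreover have "det P * det P' = 1"
    using inv by (metis det_I det_mul)
  ultimately show ?thesis
    by (simp add: det_mul mult.commute mult.left_commute)
qed

text \<open>The matrix \<open>I + t E\<^sub>i\<^sub>j\<close> arises from \<open>I\<close> by a row operation.\<close>

lemma line_direction_unit_matrix: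
  assumes "i \<noteq> j"
  shows "line_direction (unit_matrix i j :: real ^ 'n ^ 'n)"
  unfolding line_direction_def
proof
  fix t
  have "mat 1 + t *\<^sub>R unit_matrix i j
      = (\<chi> k. if k = i then row i (mat 1) + t *s row j (mat 1) else row k (mat 1 :: real ^ 'n ^ 'n))"
    by (auto simp: vec_eq_iff unit_matrix_nth row_def mat_def)
  then show "det (mat 1 + t *\<^sub>R unit_matrix i j :: real ^ 'n ^ 'n) = 1"
    by (simp add: det_row_operation[OF assms])
qed

text \<open>The direction is conjugate to \<open>E\<^sub>i\<^sub>j\<close> by the shear \<open>I + E\<^sub>j\<^sub>i\<close>.\<close>

lemma line_direction_diagonal_direction:
  assumes "i \<noteq> j"
  shows "line_direction (diagonal_direction i j :: real ^ 'n ^ 'n)"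
proof -
  let ?P = "mat 1 + unit_matrix j i :: real ^ 'n ^ 'n" and ?P' = "mat 1 - unit_matrix j i :: real ^ 'n ^ 'n"
  have "?P ** ?P' = mat 1"
    using assms by (simp add: matrix_mult_linear unit_matrix_mult)
  moreover have "?P ** unit_matrix i j ** ?P' = diagonal_direction i j"
    using assms by (simp add: matrix_mult_linear unit_matrix_mult
        diagonal_direction_def)
  ultimately show ?thesis
    using det_conjugate_line[of ?P ?P' _ "unit_matrix i j"] line_direction_unit_matrix[OF assms]
    by (simp add: line_direction_def)
qed

lemma line_direction_curve:
  fixes A N :: "real ^ 'n ^ 'n"
  assumes A: "A \<in> SL" and N: "line_direction N"
  shows "smooth_SL_curve A (N ** A) (\<lambda>t. (mat 1 + t *\<^sub>R N) ** A)"
proof -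
  let ?F = "\<lambda>k t. if k = 0 then A + t *\<^sub>R (N ** A) else if k = 1 then N ** A else 0"
  have eq: "(mat 1 + t *\<^sub>R N) ** A = A + t *\<^sub>R (N ** A)" for t
    by (simp add: matrix_mult_linear)
  have der: "((\<lambda>t. A + t *\<^sub>R (N ** A)) has_vector_derivative N ** A) (at t)" for t
    by (auto intro!: derivative_eq_intros)
  have "(\<forall>t\<in>{-1<..<1}. (mat 1 + t *\<^sub>R N) ** A \<in> SL) \<and>
      (\<exists>F. (\<forall>t\<in>{-1<..<1}. F 0 t = (mat 1 + t *\<^sub>R N) ** A) \<and>
        (\<forall>k. \<forall>t\<in>{-1<..<1}. (F k has_vector_derivative F (Suc k) t) (at t)))"
  proof (intro conjI exI[of _ ?F])
    show "\<forall>t\<in>{-1<..<1}. (mat 1 + t *\<^sub>R N) ** A \<in> SL"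
      using A N by (simp add: SL_def line_direction_def det_mul)
    show "\<forall>k. \<forall>t\<in>{-1<..<1}. (?F k has_vector_derivative ?F (Suc k) t) (at t)"
      using der by simp
  qed (simp add: eq)
  then show ?thesis
    unfolding smooth_SL_curve_def using der[of 0]
    by (intro conjI exI[of _ 1]) (simp_all add: eq)
qed

lemma frobenius_unit_matrix: "frobenius D (unit_matrix i j) = D $ i $ j"
proof -
  have "frobenius D (unit_matrix i j) = (\<Sum>k\<in>UNIV. \<Sum>l\<in>UNIV. if l = j then (if k = i then D $ i $ j else 0) else 0)"
    unfolding frobenius_def unit_matrix_nth by (intro sum.cong) auto
  then show ?thesis by simp
qed

lemma frobenius_diff_left: "frobenius (D - D') N = frobenius D N - frobenius D' N"
  by (simp add: frobenius_def algebra_simps sum_subtractf)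

lemma frobenius_diagonal_direction:
  "frobenius D (diagonal_direction i j) = D $ i $ j + D $ j $ j - D $ i $ i - D $ j $ i"
proof -
  have "frobenius D (diagonal_direction i j) = frobenius D (unit_matrix i j) + frobenius D (unit_matrix j j)
      - frobenius D (unit_matrix i i) - frobenius D (unit_matrix j i)"
    by (simp add: frobenius_def diagonal_direction_def algebra_simps sum.distrib sum_subtractf)
  then show ?thesis
    by (simp add: frobenius_unit_matrix)
qed

lemma trace_unit_matrix: "trace (unit_matrix i j) = (if i = j then 1 else 0)"
proof -
  have "trace (unit_matrix i j) = (\<Sum>k\<in>UNIV. if k = i then (if i = j then 1 else 0) else 0)"
    unfolding trace_def unit_matrix_nth by (intro sum.cong) auto
  then show ?thesis by simp
qed

lemma trace_diagonal_direction: "trace (diagonal_direction i j) = 0"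
  by (simp add: diagonal_direction_def trace_add trace_sub trace_unit_matrix)

text \<open>Orthogonality to \<open>E\<^sub>i\<^sub>j\<close> kills the off-diagonal entries, orthogonality to the diagonal directions
  makes all diagonal entries equal, and their sum is the trace.\<close>

lemma traceless_eq_zero:
  fixes D :: "real ^ 'n ^ 'n"
  assumes tr: "trace D = 0"
    and orth: "\<And>N. line_direction N \<Longrightarrow> trace N = 0 \<Longrightarrow> frobenius D N = 0"
  shows "D = 0"
proof -
  have off: "D $ i $ j = 0" if "i \<noteq> j" for i j
    using orth[OF line_direction_unit_matrix[OF that]] that
    by (simp add: frobenius_unit_matrix trace_unit_matrix)
  have diag: "D $ i $ i = D $ j $ j" for i j
  proof (cases "i = j")
    case False
    then show ?thesis
      using orth[OF line_direction_diagonal_direction[OF False]]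
      by (simp add: trace_diagonal_direction frobenius_diagonal_direction off)
  qed simp
  have "D $ i $ i = 0" for i
  proof -
    have "0 = (\<Sum>j\<in>UNIV. D $ j $ j)"
      using tr by (simp add: trace_def)
    also have "\<dots> = (\<Sum>j\<in>(UNIV :: 'n set). D $ i $ i)"
      by (rule sum.cong[OF refl diag])
    finally show ?thesis by simp
  qed
  with off have "D $ i $ j = 0" for i j
    by (cases "i = j") auto
  then show ?thesis
    by (simp add: vec_eq_iff)
qed

lemma SL_mult_matrix_inv: "A \<in> SL \<Longrightarrow> A ** matrix_inv A = mat 1"
  unfolding matrix_inv_def
  by (rule someI2_ex) (auto simp: SL_def invertible_det_nz simp flip: invertible_def)

lemma SL_metric_eq_frobenius:
  fixes A D N :: "real ^ 'n ^ 'n"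
  assumes "A \<in> SL"
  shows "SL_metric A (D ** A) (N ** A) = frobenius D N"
proof -
  have "(D ** A) ** matrix_inv A = D" for D :: "real ^ 'n ^ 'n"
    by (simp add: SL_mult_matrix_inv[OF assms] flip: matrix_mul_assoc)
  then have "SL_metric A (D ** A) (N ** A) = trace (D ** transpose N)"
    by (simp only: SL_metric_def)
  then show ?thesis
    by (simp add: trace_def frobenius_def matrix_matrix_mult_def transpose_def)
qed

lemma riemannian_gradient_unique:
  assumes A: "A \<in> SL" and G: "is_riemannian_gradient f A G" and G': "is_riemannian_gradient f A G'"
  shows "G = G'"
proof -
  from G obtain D where D: "trace D = 0" "G = D ** A"
    by (auto simp: is_riemannian_gradient_def SL_tangent_def)
  from G' obtain D' where D': "trace D' = 0" "G' = D' ** A"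
    by (auto simp: is_riemannian_gradient_def SL_tangent_def)
  have "frobenius (D - D') N = 0" if N: "line_direction N" "trace N = 0" for N
  proof -
    have "N ** A \<in> SL_tangent A"
      using N(2) by (auto simp: SL_tangent_def)
    then have "has_directional_derivative f A (N ** A) (frobenius D N)"
      "has_directional_derivative f A (N ** A) (frobenius D' N)"
      using G G' unfolding is_riemannian_gradient_def D D'
      by (metis SL_metric_eq_frobenius[OF A])+
    then have "frobenius D N = frobenius D' N"
      using line_direction_curve[OF A N(1)] unfolding has_directional_derivative_def
      by (blast intro: DERIV_unique)
    then show ?thesis
      by (simp add: frobenius_diff_left)
  qed
  then have "D - D' = 0"
    using D D' by (intro traceless_eq_zero) (auto simp: trace_sub)
  with D D' show ?thesis by simp
qed

lemma riemannian_grad_eq: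
  assumes "A \<in> SL" "is_riemannian_gradient f A G"
  shows "riemannian_grad f A = G"
  unfolding riemannian_grad_def
  using assms riemannian_gradient_unique by (intro the_equality) blast+

section \<open>Derivatives along curves in the special linear group\<close>

lemma frechet_derivative_eq_gradient:
  fixes u :: "real ^ 'n \<Rightarrow> real"
  assumes "u differentiable (at y)"
  shows "frechet_derivative u (at y) h = gradient u y \<bullet> h"
proof -
  interpret linear "frechet_derivative u (at y)"
    by (rule linear_frechet_derivative[OF assms])
  have "frechet_derivative u (at y) (\<Sum>j\<in>UNIV. h $ j *\<^sub>R axis j 1)
      = (\<Sum>j\<in>UNIV. h $ j * frechet_derivative u (at y) (axis j 1))"
    by (simp add: sum scaleR)
  moreover have "(\<Sum>j\<in>UNIV. h $ j *\<^sub>R axis j 1) = h"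
    using basis_expansion[of h] by (simp add: scalar_mult_eq_scaleR)
  ultimately show ?thesis
    by (simp add: gradient_def inner_vec_def mult.commute)
qed

lemma evaluation_curve_derivative:
  fixes u :: "real ^ 'n \<Rightarrow> real" and \<Theta> :: "real \<Rightarrow> real ^ 'n ^ 'n"
  assumes u: "u differentiable (at (\<Theta> 0 *v x))" and \<Theta>: "(\<Theta> has_vector_derivative V) (at 0)"
  shows "((\<lambda>\<epsilon>. u (\<Theta> \<epsilon> *v x)) has_real_derivative gradient u (\<Theta> 0 *v x) \<bullet> (V *v x)) (at 0)"
proof -
  have "linear (\<lambda>B :: real ^ 'n ^ 'n. B *v x)"
    by (rule linearI)
      (simp_all add: vec_eq_iff matrix_vector_mult_def algebra_simps sum.distrib sum_distrib_left)
  then have lin: "bounded_linear (\<lambda>B :: real ^ 'n ^ 'n. B *v x)"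
    by (rule linear_conv_bounded_linear[THEN iffD1])
  have curve: "((\<lambda>\<epsilon>. \<Theta> \<epsilon> *v x) has_vector_derivative V *v x) (at 0)"
    by (rule bounded_linear.has_vector_derivative[OF lin \<Theta>])
  have "(u has_derivative frechet_derivative u (at (\<Theta> 0 *v x))) (at (\<Theta> 0 *v x))"
    using u by (rule frechet_derivative_works[THEN iffD1])
  from vector_derivative_diff_chain_within[OF curve has_derivative_at_withinI[OF this]]
  show ?thesis
    by (simp only: o_def frechet_derivative_eq_gradient[OF u] has_real_derivative_iff_has_vector_derivative)
qed

lemma smooth_SL_curveD:
  assumes "smooth_SL_curve A V \<Theta>"
  shows "\<Theta> 0 = A" "(\<Theta> has_vector_derivative V) (at 0)"
  using assms unfolding smooth_SL_curve_def by blast+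

lemma smooth_SL_curve_eventually_SL:
  assumes "smooth_SL_curve A V \<Theta>"
  shows "\<forall>\<^sub>F \<epsilon> in nhds 0. \<Theta> \<epsilon> \<in> SL"
proof -
  obtain \<delta> where "0 < \<delta>" "\<forall>t\<in>{-\<delta><..<\<delta>}. \<Theta> t \<in> SL"
    using assms unfolding smooth_SL_curve_def by blast
  then show ?thesis
    by (intro eventually_nhds_in_open[of "{-\<delta><..<\<delta>}", THEN eventually_mono]) auto
qed

lemma smooth_SL_curve_eventually_SL_at:
  "smooth_SL_curve A V \<Theta> \<Longrightarrow> \<forall>\<^sub>F \<epsilon> in at 0. \<Theta> \<epsilon> \<in> SL"
  unfolding eventually_at_filter
  by (drule smooth_SL_curve_eventually_SL) (auto elim: eventually_mono)

lemma square_integrable_difference_quotient: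
  assumes "square_integrable M f" "square_integrable M g"
  shows "square_integrable M (\<lambda>x. (f x - g x) / \<epsilon>)"
  using square_integrable_scale[OF square_integrable_diff[OF assms], of "inverse \<epsilon>"]
  by (simp add: divide_inverse mult.commute)

text \<open>At each point of the domain the difference quotients converge to \<open>\<nabla>u(Ax)\<^sup>T V x\<close> by the chain rule, while
  in \<open>L\<^sup>2\<close> they converge to \<open>w\<close>.\<close>

lemma L2_directional_derivative_eq_gradient:
  fixes u :: "real ^ 'n \<Rightarrow> real" and A :: "real ^ 'n ^ 'n"
  assumes E: "\<And>B. B \<in> SL \<Longrightarrow> square_integrable M (E_eval u B)"
    and A: "A \<in> SL"
    and u: "\<And>x. x \<in> space M \<Longrightarrow> u differentiable (at (A *v x))"
    and w: "has_L2_directional_derivative M (E_eval u) A V w"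
    and \<Theta>: "smooth_SL_curve A V \<Theta>"
  shows "square_integrable M (\<lambda>x. gradient u (A *v x) \<bullet> (V *v x))"
    and "AE x in M. w x = gradient u (A *v x) \<bullet> (V *v x)"
proof -
  have \<Theta>0: "\<Theta> 0 = A" and d\<Theta>: "(\<Theta> has_vector_derivative V) (at 0)"
    using smooth_SL_curveD[OF \<Theta>] by auto
  \<comment> \<open>Fatou's lemma is about sequences, so the curve is sampled along a null sequence.\<close>
  define \<epsilon> :: "nat \<Rightarrow> real" where "\<epsilon> n = inverse (real (Suc n))" for n
  have \<epsilon>: "filterlim \<epsilon> (at 0) sequentially"
    unfolding filterlim_at
  proof
    show "\<epsilon> \<longlonglongrightarrow> 0"
      unfolding \<epsilon>_def[abs_def] by (rule LIMSEQ_inverse_real_of_nat)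
  qed (simp add: \<epsilon>_def)
  let ?f = "\<lambda>n x. (E_eval u (\<Theta> (\<epsilon> n)) x - E_eval u A x) / \<epsilon> n"
  have w2: "square_integrable M w"
    using w by (simp add: has_L2_directional_derivative_def)
  have f2: "\<forall>\<^sub>F n in sequentially. square_integrable M (?f n)"
    using eventually_compose_filterlim[OF smooth_SL_curve_eventually_SL_at[OF \<Theta>] \<epsilon>]
    by eventually_elim (intro square_integrable_difference_quotient E A)
  have "((\<lambda>\<epsilon>. L2norm M (\<lambda>x. (E_eval u (\<Theta> \<epsilon>) x - E_eval u A x) / \<epsilon> - w x)) \<longlongrightarrow> 0) (at 0)"
    by (rule w[unfolded has_L2_directional_derivative_def, THEN conjunct2, rule_format, OF \<Theta>])
  from filterlim_compose[OF this \<epsilon>] have lim: "(\<lambda>n. L2norm M (\<lambda>x. ?f n x - w x)) \<longlonglongrightarrow> 0" .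
  have pw: "(\<lambda>n. ?f n x) \<longlonglongrightarrow> gradient u (A *v x) \<bullet> (V *v x)" if "x \<in> space M" for x
  proof -
    have "((\<lambda>\<epsilon>. u (\<Theta> \<epsilon> *v x)) has_real_derivative gradient u (A *v x) \<bullet> (V *v x)) (at 0)"
      using evaluation_curve_derivative[of u \<Theta> x V] u[OF that] d\<Theta> by (simp add: \<Theta>0)
    then have "((\<lambda>h. (u (\<Theta> h *v x) - u (A *v x)) / h) \<longlongrightarrow> gradient u (A *v x) \<bullet> (V *v x)) (at 0)"
      by (simp add: DERIV_def \<Theta>0)
    from filterlim_compose[OF this \<epsilon>] show ?thesis
      by (simp add: E_eval_def)
  qed
  note eq = L2_limit_eq_pointwise_limit[where f="?f" and g="\<lambda>x. gradient u (A *v x) \<bullet> (V *v x)", OF w2 f2 lim pw]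
  show ae: "AE x in M. w x = gradient u (A *v x) \<bullet> (V *v x)"
    by (rule eq(2))
  show "square_integrable M (\<lambda>x. gradient u (A *v x) \<bullet> (V *v x))"
    by (rule square_integrable_cong_AE[OF w2 eq(1) ae])
qed

lemma pairing_curve_derivative:
  fixes u :: "real ^ 'n \<Rightarrow> real" and A :: "real ^ 'n ^ 'n"
  assumes E: "\<And>B. B \<in> SL \<Longrightarrow> square_integrable M (E_eval u B)"
    and A: "A \<in> SL"
    and w: "has_L2_directional_derivative M (E_eval u) A V w"
    and \<Theta>: "smooth_SL_curve A V \<Theta>" and h: "square_integrable M h"
  shows "((\<lambda>\<epsilon>. LINT x|M. E_eval u (\<Theta> \<epsilon>) x * h x) has_real_derivative (LINT x|M. w x * h x)) (at 0)"
proof -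
  have \<Theta>0: "\<Theta> 0 = A"
    by (rule smooth_SL_curveD(1)[OF \<Theta>])
  let ?f = "\<lambda>\<epsilon> x. (E_eval u (\<Theta> \<epsilon>) x - E_eval u A x) / \<epsilon>"
  have "((\<lambda>\<epsilon>. LINT x|M. ?f \<epsilon> x * h x) \<longlongrightarrow> (LINT x|M. w x * h x)) (at 0)"
  proof (rule L2_inner_continuous[OF h])
    show "square_integrable M w"
      using w by (simp add: has_L2_directional_derivative_def)
    show "((\<lambda>\<epsilon>. L2norm M (\<lambda>x. ?f \<epsilon> x - w x)) \<longlongrightarrow> 0) (at 0)"
      by (rule w[unfolded has_L2_directional_derivative_def, THEN conjunct2, rule_format, OF \<Theta>])
    show "\<forall>\<^sub>F \<epsilon> in at 0. square_integrable M (?f \<epsilon>)"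
      using smooth_SL_curve_eventually_SL_at[OF \<Theta>]
      by eventually_elim (intro square_integrable_difference_quotient E A)
  qed
  moreover have "\<forall>\<^sub>F \<epsilon> in at 0. (LINT x|M. ?f \<epsilon> x * h x)
      = ((LINT x|M. E_eval u (\<Theta> \<epsilon>) x * h x) - (LINT x|M. E_eval u A x * h x)) / \<epsilon>"
    using smooth_SL_curve_eventually_SL_at[OF \<Theta>]
  proof eventually_elim
    case (elim \<epsilon>)
    note int = square_integrable_imp_integrable_mult[OF E[OF elim] h]
      square_integrable_imp_integrable_mult[OF E[OF A] h]
    have "(LINT x|M. ?f \<epsilon> x * h x) = (LINT x|M. (E_eval u (\<Theta> \<epsilon>) x * h x - E_eval u A x * h x) / \<epsilon>)"
      by (simp add: left_diff_distrib)
    then show ?case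
      by (simp add: int)
  qed
  ultimately have "((\<lambda>\<epsilon>. ((LINT x|M. E_eval u (\<Theta> \<epsilon>) x * h x) - (LINT x|M. E_eval u A x * h x)) / \<epsilon>)
      \<longlongrightarrow> (LINT x|M. w x * h x)) (at 0)"
    by (rule Lim_transform_eventually)
  then show ?thesis
    by (simp add: DERIV_def \<Theta>0)
qed

context product_factors
begin

text \<open>Along the curve, \<open>S(f) \<ge> \<Sum>\<^sub>i \<langle>f, Q\<^bsub>\<le>i\<^esub> Q\<^bsub>>i\<^esub>\<rangle>\<close> with the cores fixed at their values for \<open>A\<close>, and equality holds at
  \<open>\<epsilon> = 0\<close>. The difference of the two sides has a minimum there. Both sides are differentiable, the right
  one because it is linear in \<open>f\<close>, so their derivatives coincide.\<close>

lemma S_cost_directional_derivative_eq: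
  fixes u :: "real ^ 'n::{finite,linorder} \<Rightarrow> real"
    and A V :: "real ^ 'n::{finite,linorder} ^ 'n::{finite,linorder}"
  assumes E: "\<And>B. B \<in> SL \<Longrightarrow> square_integrable PM (E_eval u B)"
    and S: "\<And>B i. B \<in> SL \<Longrightarrow> i \<in> {1..<CARD('n)} \<Longrightarrow> \<exists>s. has_singular_value_sum \<mu> i (E_eval u B) s"
    and A: "A \<in> SL"
    and w: "has_L2_directional_derivative PM (E_eval u) A V w"
    and c: "has_directional_derivative (S_cost \<mu> \<circ> E_eval u) A V c"
    and orth: "\<And>i. i \<in> {1..<CARD('n)} \<Longrightarrow> orthogonalized_FTT \<mu> i (E_eval u A) r (Q i) (\<sigma> i)"
    and \<Theta>: "smooth_SL_curve A V \<Theta>"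
  shows "c = (\<Sum>i\<in>{1..<CARD('n)}. LINT x|PM. w x *
      separated_sum i {1..r i} (\<lambda>_. 1) (Q_le r (Q i) i) (Q_gt r (Q i) CARD('n) i) x)"
proof -
  let ?h = "\<lambda>i. separated_sum i {1..r i} (\<lambda>_. 1) (Q_le r (Q i) i) (Q_gt r (Q i) CARD('n) i)"
  have on: "L2_orthonormal (Pi\<^sub>M {1..i} \<mu>) {1..r i} (Q_le r (Q i) i)"
    "L2_orthonormal (Pi\<^sub>M {i<..CARD('n)} \<mu>) {1..r i} (Q_gt r (Q i) CARD('n) i)"
    if "i \<in> {1..<CARD('n)}" for i
    using orth[OF that] unfolding orthogonalized_FTT_def by blast+
  have h: "square_integrable PM (?h i)" if "i \<in> {1..<CARD('n)}" for i
    by (rule square_integrable_separated_sum[OF that on[OF that]])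
  let ?P = "\<lambda>B. \<Sum>i\<in>{1..<CARD('n)}. LINT x|PM. E_eval u B x * ?h i x"
  have \<Theta>0: "\<Theta> 0 = A"
    by (rule smooth_SL_curveD(1)[OF \<Theta>])
  let ?D = "\<lambda>\<epsilon>. S_cost \<mu> (E_eval u (\<Theta> \<epsilon>)) - ?P (\<Theta> \<epsilon>)"
  let ?d = "c - (\<Sum>i\<in>{1..<CARD('n)}. LINT x|PM. w x * ?h i x)"
  have "((\<lambda>\<epsilon>. S_cost \<mu> (E_eval u (\<Theta> \<epsilon>))) has_real_derivative c) (at 0)"
    using c \<Theta> by (simp add: has_directional_derivative_def)
  moreover have "((\<lambda>\<epsilon>. ?P (\<Theta> \<epsilon>)) has_real_derivative
      (\<Sum>i\<in>{1..<CARD('n)}. LINT x|PM. w x * ?h i x)) (at 0)"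
    by (intro DERIV_sum pairing_curve_derivative[OF E A w \<Theta>] h)
  ultimately have der: "(?D has_real_derivative ?d) (at 0)"
    by (rule DERIV_diff)
  have zero: "?D 0 = 0"
    using S_cost_orthogonalized_FTT[OF E[OF A] orth] by (simp add: \<Theta>0)
  have nonneg: "0 \<le> ?D \<epsilon>" if "\<Theta> \<epsilon> \<in> SL" for \<epsilon>
    using pairing_le_S_cost[OF S[OF that] on] by simp
  from smooth_SL_curve_eventually_SL[OF \<Theta>] obtain \<delta> where \<delta>: "0 < \<delta>" "\<And>\<epsilon>. \<bar>\<epsilon>\<bar> < \<delta> \<Longrightarrow> \<Theta> \<epsilon> \<in> SL"
    by (auto simp: eventually_nhds_metric dist_real_def)
  have "?d = 0"
    by (rule DERIV_local_min[OF der \<delta>(1)]) (use nonneg \<delta>(2) in \<open>simp only: zero, auto\<close>)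
  then show ?thesis by simp
qed

end

section \<open>The integral formula for the matrix\<close>

definition traceless_outer :: "real ^ 'n \<Rightarrow> real ^ 'n \<Rightarrow> real ^ 'n ^ 'n"
  where "traceless_outer g y = outer g y - ((g \<bullet> y) / real CARD('n)) *\<^sub>R mat 1"

lemma trace_traceless_outer: "trace (traceless_outer g y) = 0"
  by (simp add: trace_def traceless_outer_def outer_def mat_def inner_vec_def sum_subtractf)

text \<open>The correction \<open>(g\<^sup>T y / d) I\<close> is orthogonal to every traceless \<open>N\<close>; it makes the matrix tangent without
  changing its pairings with tangent directions.\<close>

lemma frobenius_traceless_outer:
  assumes "trace N = 0"
  shows "frobenius (traceless_outer g y) N = g \<bullet> (N *v y)"
proof -
  have "frobenius (traceless_outer g y) N
      = (\<Sum>i\<in>UNIV. \<Sum>j\<in>UNIV. g $ i * y $ j * N $ i $ j - (if i = j then (g \<bullet> y) / real CARD('a) * N $ i $ i else 0))"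
    unfolding frobenius_def
    by (intro sum.cong refl) (simp add: traceless_outer_def outer_def mat_def left_diff_distrib)
  also have "\<dots> = (\<Sum>i\<in>UNIV. \<Sum>j\<in>UNIV. g $ i * y $ j * N $ i $ j) - (g \<bullet> y) / real CARD('a) * trace N"
    by (simp add: sum_subtractf trace_def sum_distrib_left)
  also have "\<dots> = g \<bullet> (N *v y)"
    using assms by (simp add: inner_vec_def matrix_vector_mult_def sum_distrib_left mult_ac)
  finally show ?thesis .
qed

lemma bounded_linear_frobenius: "bounded_linear (\<lambda>D. frobenius D N)"
proof (rule linear_conv_bounded_linear[THEN iffD1], rule linearI)
  show "frobenius (D + D') N = frobenius D N + frobenius D' N" for D D'
    by (simp add: frobenius_def distrib_right sum.distrib)
  show "frobenius (c *\<^sub>R D) N = c *\<^sub>R frobenius D N" for c D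
    by (simp add: frobenius_def sum_distrib_left mult.assoc)
qed

text \<open>The entries are linear combinations of pairings \<open>g\<^sup>T N y\<close> with the spanning line directions. A single
  product \<open>g\<^sub>i y\<^sub>i\<close> is not such a combination, only the differences \<open>g\<^sub>i y\<^sub>i - g\<^sub>j y\<^sub>j\<close> are, and the diagonal entries of the
  traceless part are means of these.\<close>

lemma square_integrable_traceless_outer:
  fixes g y :: "'a \<Rightarrow> real ^ 'n"
  assumes dir: "\<And>N. line_direction N \<Longrightarrow> trace N = 0 \<Longrightarrow> square_integrable M (\<lambda>x. g x \<bullet> (N *v y x))"
  shows "square_integrable M (\<lambda>x. traceless_outer (g x) (y x) $ i $ j)"
proof -
  let ?T = "\<lambda>x. traceless_outer (g x) (y x)"
  have frob: "square_integrable M (\<lambda>x. frobenius (?T x) N)" if "line_direction N" "trace N = 0" for N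
    using dir[OF that] by (simp add: frobenius_traceless_outer that)
  have off: "square_integrable M (\<lambda>x. ?T x $ i $ j)" if "i \<noteq> j" for i j
    using frob[OF line_direction_unit_matrix[OF that]] that
    by (simp add: trace_unit_matrix frobenius_unit_matrix)
  have diff: "square_integrable M (\<lambda>x. ?T x $ i $ i - ?T x $ j $ j)" for i j
  proof (cases "i = j")
    case False
    then have "square_integrable M (\<lambda>x. frobenius (?T x) (diagonal_direction j i))"
      by (intro frob line_direction_diagonal_direction trace_diagonal_direction) auto
    then have "square_integrable M (\<lambda>x. frobenius (?T x) (diagonal_direction j i) - ?T x $ j $ i + ?T x $ i $ j)"
      using False by (intro square_integrable_add square_integrable_diff off) auto
    then show ?thesis
      by (simp add: frobenius_diagonal_direction)
  qed (simp add: square_integrable_def)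
  show ?thesis
  proof (cases "i = j")
    case True
    have tr: "(\<Sum>k\<in>UNIV. ?T x $ k $ k) = 0" for x
      using trace_traceless_outer[of "g x" "y x"] by (simp only: trace_def)
    have mean: "(\<lambda>x. ?T x $ i $ i) = (\<lambda>x. (1 / real CARD('n)) * (\<Sum>k\<in>UNIV. ?T x $ i $ i - ?T x $ k $ k))"
      by (simp add: sum_subtractf tr)
    have "square_integrable M (\<lambda>x. (1 / real CARD('n)) * (\<Sum>k\<in>UNIV. ?T x $ i $ i - ?T x $ k $ k))"
      by (intro square_integrable_scale square_integrable_sum diff)
    then have "square_integrable M (\<lambda>x. ?T x $ i $ i)"
      by (subst mean)
    with True show ?thesis by simp
  qed (rule off)
qed

lemma integrable_matrix:
  fixes H :: "'a \<Rightarrow> real ^ 'n ^ 'm"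
  assumes "\<And>i j. integrable M (\<lambda>x. H x $ i $ j)"
  shows "integrable M H"
proof -
  have "H x = (\<Sum>i\<in>UNIV. \<Sum>j\<in>UNIV. (H x $ i $ j) *\<^sub>R axis i (axis j 1))" for x
  proof -
    have entry: "H x $ k $ l = (\<Sum>i\<in>UNIV. \<Sum>j\<in>UNIV. ((H x $ i $ j) *\<^sub>R axis i (axis j 1)) $ k $ l)" for k l
    proof -
      have "H x $ k $ l = (\<Sum>i\<in>UNIV. \<Sum>j\<in>UNIV. if j = l then (if i = k then H x $ k $ l else 0) else 0)"
        by simp
      also have "\<dots> = (\<Sum>i\<in>UNIV. \<Sum>j\<in>UNIV. ((H x $ i $ j) *\<^sub>R axis i (axis j 1)) $ k $ l)"
        by (intro sum.cong refl) (auto simp: axis_def)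
      finally show ?thesis .
    qed
    show ?thesis
      unfolding vec_eq_iff sum_component by (intro allI entry)
  qed
  then have expansion: "H = (\<lambda>x. \<Sum>i\<in>UNIV. \<Sum>j\<in>UNIV. (H x $ i $ j) *\<^sub>R axis i (axis j 1))"
    by (rule ext)
  show ?thesis
    by (subst expansion)
      (intro Bochner_Integration.integrable_sum integrable_scaleR_left assms)
qed

lemma frobenius_integral_traceless_outer:
  fixes g y :: "'a \<Rightarrow> real ^ 'n"
  assumes dir: "\<And>N. line_direction N \<Longrightarrow> trace N = 0 \<Longrightarrow> square_integrable M (\<lambda>x. g x \<bullet> (N *v y x))"
    and h: "square_integrable M h" and N: "trace N = 0"
  shows "frobenius (LINT x|M. h x *\<^sub>R traceless_outer (g x) (y x)) N = (LINT x|M. (g x \<bullet> (N *v y x)) * h x)"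
proof -
  have int: "integrable M (\<lambda>x. h x *\<^sub>R traceless_outer (g x) (y x))"
    by (rule integrable_matrix)
      (use square_integrable_imp_integrable_mult[OF h square_integrable_traceless_outer[OF dir]] in simp)
  have scale: "frobenius (s *\<^sub>R D) N = s * frobenius D N" for s and D :: "real ^ 'n ^ 'n"
    by (simp add: frobenius_def sum_distrib_left mult.assoc)
  show ?thesis
    unfolding integral_bounded_linear[OF bounded_linear_frobenius int, symmetric] scale
      frobenius_traceless_outer[OF N] by (simp add: mult.commute)
qed

section \<open>The Riemannian gradient\<close>

text \<open>The trace commutes with the Bochner integral of an integrable function; for a function that is not
  integrable the integral is \<open>0\<close> by convention.\<close>

lemma traceless_D_matrix:
  fixes A :: "real ^ 'n::{finite,linorder} ^ 'n::{finite,linorder}"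
  shows "trace (D_matrix \<mu> u A r Q) = 0"
proof -
  have trace_frobenius: "trace D = frobenius D (mat 1)" for D :: "real ^ 'n::{finite,linorder} ^ 'n::{finite,linorder}"
    by (simp add: trace_def frobenius_def mat_def if_distrib cong: if_cong)
  have trace: "bounded_linear (trace :: real ^ 'n::{finite,linorder} ^ 'n::{finite,linorder} \<Rightarrow> real)"
    unfolding trace_frobenius[abs_def] by (rule bounded_linear_frobenius)
  have trace_integral: "trace (LINT x|M. h x *\<^sub>R traceless_outer (g x) (y x)) = 0"
    for M :: "'b measure" and h and g y :: "'b \<Rightarrow> real ^ 'n::{finite,linorder}"
  proof (cases "integrable M (\<lambda>x. h x *\<^sub>R traceless_outer (g x) (y x))")
    case True
    have "trace (s *\<^sub>R traceless_outer a b) = 0" for s and a b :: "real ^ 'n::{finite,linorder}"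
      by (simp add: linear_cmul[OF bounded_linear.linear[OF trace]] trace_traceless_outer)
    with integral_bounded_linear[OF trace True] show ?thesis by simp
  next
    case False
    then show ?thesis
      by (simp add: not_integrable_integral_eq trace_def)
  qed
  show ?thesis
    unfolding D_matrix_def traceless_outer_def[symmetric]
      linear_sum[OF bounded_linear.linear[OF trace]] trace_integral
    by simp
qed

theorem proposition4p1:
  fixes \<Omega> :: "nat \<Rightarrow> real set"
    and \<mu> :: "nat \<Rightarrow> real measure"
    and u :: "real ^ 'n::{finite,linorder} \<Rightarrow> real"
    and r\<^sub>u r :: "nat \<Rightarrow> nat"
    and \<Psi> :: "nat \<Rightarrow> real \<Rightarrow> nat \<Rightarrow> nat \<Rightarrow> real"
    and A :: "real ^ 'n::{finite,linorder} ^ 'n::{finite,linorder}"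
    and Q :: "nat \<Rightarrow> nat \<Rightarrow> real \<Rightarrow> nat \<Rightarrow> nat \<Rightarrow> real"
    and \<sigma> :: "nat \<Rightarrow> nat \<Rightarrow> real"
  assumes measures: "\<And>k. k \<in> {1..CARD('n)} \<Longrightarrow>
      finite_measure (\<mu> k) \<and> sets (\<mu> k) = sets (restrict_space borel (\<Omega> k))"
    and u_FTT: "is_FTT r\<^sub>u \<Psi> u"
    and u_L2: "square_integrable (product_measure \<mu>) u"
    and E_L2: "\<And>B. B \<in> SL \<Longrightarrow> square_integrable (product_measure \<mu>) (E_eval u B)"
    and S_finite: "\<And>B i. B \<in> SL \<Longrightarrow> i \<in> {1..<CARD('n)} \<Longrightarrow> \<exists>s. has_singular_value_sum \<mu> i (E_eval u B) s"
    and A_SL: "A \<in> SL"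
    and u_diff: "\<And>x. x \<in> separable_domain \<Omega> \<Longrightarrow> u differentiable (at (A *v x))"
    and E_diff: "\<And>V. V \<in> SL_tangent A \<Longrightarrow>
      \<exists>w. has_L2_directional_derivative (product_measure \<mu>) (E_eval u) A V w"
    and C_diff: "\<And>V. V \<in> SL_tangent A \<Longrightarrow>
      \<exists>c. has_directional_derivative (S_cost \<mu> \<circ> E_eval u) A V c"
    and v_orth: "\<And>i. i \<in> {1..<CARD('n)} \<Longrightarrow>
      orthogonalized_FTT \<mu> i (\<lambda>x. u (A *v x)) r (Q i) (\<sigma> i)"
  shows "is_riemannian_gradient (S_cost \<mu> \<circ> E_eval u) A (D_matrix \<mu> u A r Q ** A)
    \<and> riemannian_grad (S_cost \<mu> \<circ> E_eval u) A = D_matrix \<mu> u A r Q ** A"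
proof -
  have "product_factors TYPE('n) \<mu> \<Omega>"
  proof (rule product_factors.intro)
    fix k assume k: "k \<in> {1..CARD('n)}"
    show "finite_measure (\<mu> k)"
      using measures[OF k] by simp
    show "sets (\<mu> k) = sets (restrict_space borel (\<Omega> k))"
      using measures[OF k] by simp
  qed
  then interpret product_factors \<mu> \<Omega> "TYPE('n)" .
  let ?M = "product_measure \<mu> :: (real ^ 'n::{finite,linorder}) measure" and ?D = "D_matrix \<mu> u A r Q"
  let ?h = "\<lambda>i. separated_sum i {1..r i} (\<lambda>_. 1) (Q_le r (Q i) i) (Q_gt r (Q i) CARD('n) i)"
  let ?g = "\<lambda>x. gradient u (A *v x)"
  have u_diff': "u differentiable (at (A *v x))" if "x \<in> space ?M" for x
    using that by (intro u_diff) (simp add: space_product_measure)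
  have v_orth': "orthogonalized_FTT \<mu> i (E_eval u A) r (Q i) (\<sigma> i)" if "i \<in> {1..<CARD('n)}" for i
    using v_orth[OF that] by (simp only: E_eval_def)
  have h: "square_integrable ?M (?h i)" if i: "i \<in> {1..<CARD('n)}" for i
  proof (rule square_integrable_separated_sum[OF i])
    show "L2_orthonormal (Pi\<^sub>M {1..i} \<mu>) {1..r i} (Q_le r (Q i) i)"
      using v_orth[OF i] by (simp only: orthogonalized_FTT_def)
    show "L2_orthonormal (Pi\<^sub>M {i<..CARD('n)} \<mu>) {1..r i} (Q_gt r (Q i) CARD('n) i)"
      using v_orth[OF i] by (simp only: orthogonalized_FTT_def)
  qed
  have tangent: "N ** A \<in> SL_tangent A" if "trace N = 0" for N
    using that by (auto simp: SL_tangent_def)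
  \<comment> \<open>Line directions come with a curve, which forces the \<open>L\<^sup>2\<close> derivative to be \<open>\<nabla>u(Ax)\<^sup>T N A x\<close>.\<close>
  have dir: "square_integrable ?M (\<lambda>x. ?g x \<bullet> (N *v (A *v x)))"
    if N: "line_direction N" "trace N = 0" for N
  proof -
    from E_diff[OF tangent[OF N(2)]]
    obtain w where w: "has_L2_directional_derivative ?M (E_eval u) A (N ** A) w" ..
    show ?thesis
      unfolding matrix_vector_mul_assoc[of N A]
      by (rule L2_directional_derivative_eq_gradient(1)
          [OF E_L2 A_SL u_diff' w line_direction_curve[OF A_SL N(1)]])
  qed
  have D: "?D = (\<Sum>i\<in>{1..<CARD('n)}. LINT x|?M. ?h i x *\<^sub>R traceless_outer (?g x) (A *v x))"
    unfolding D_matrix_def traceless_outer_def separated_sum_def mult_1_right ..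
  have derivative: "has_directional_derivative (S_cost \<mu> \<circ> E_eval u) A (N ** A) (frobenius ?D N)"
    if N: "trace N = 0" for N
    unfolding has_directional_derivative_def
  proof (intro allI impI)
    fix \<Theta> assume \<Theta>: "smooth_SL_curve A (N ** A) \<Theta>"
    from E_diff[OF tangent[OF N]]
    obtain w where w: "has_L2_directional_derivative ?M (E_eval u) A (N ** A) w" ..
    from C_diff[OF tangent[OF N]]
    obtain c where c: "has_directional_derivative (S_cost \<mu> \<circ> E_eval u) A (N ** A) c" ..
    have direction: "square_integrable ?M (\<lambda>x. ?g x \<bullet> (N *v (A *v x)))"
      unfolding matrix_vector_mul_assoc[of N A]
      by (rule L2_directional_derivative_eq_gradient(1)[OF E_L2 A_SL u_diff' w \<Theta>])
    have w_eq: "AE x in ?M. w x = ?g x \<bullet> (N *v (A *v x))"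
      unfolding matrix_vector_mul_assoc[of N A]
      by (rule L2_directional_derivative_eq_gradient(2)[OF E_L2 A_SL u_diff' w \<Theta>])
    have "c = (\<Sum>i\<in>{1..<CARD('n)}. LINT x|?M. w x * ?h i x)"
      by (rule S_cost_directional_derivative_eq[OF E_L2 S_finite A_SL w c v_orth' \<Theta>])
    also have "\<dots> = (\<Sum>i\<in>{1..<CARD('n)}. LINT x|?M. (?g x \<bullet> (N *v (A *v x))) * ?h i x)"
    proof (intro sum.cong refl integral_cong_AE)
      fix i assume i: "i \<in> {1..<CARD('n)}"
      have [measurable]: "w \<in> borel_measurable ?M" "?h i \<in> borel_measurable ?M"
        "(\<lambda>x. ?g x \<bullet> (N *v (A *v x))) \<in> borel_measurable ?M"
        using w h[OF i] direction
        by (simp_all only: has_L2_directional_derivative_def square_integrable_def)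
      show "(\<lambda>x. w x * ?h i x) \<in> borel_measurable ?M"
        "(\<lambda>x. (?g x \<bullet> (N *v (A *v x))) * ?h i x) \<in> borel_measurable ?M"
        by measurable
      show "AE x in ?M. w x * ?h i x = (?g x \<bullet> (N *v (A *v x))) * ?h i x"
        using w_eq by eventually_elim simp
    qed
    also have "\<dots> = (\<Sum>i\<in>{1..<CARD('n)}.
        frobenius (LINT x|?M. ?h i x *\<^sub>R traceless_outer (?g x) (A *v x)) N)"
      by (intro sum.cong refl frobenius_integral_traceless_outer[symmetric] dir h N)
    also have "\<dots> = frobenius ?D N"
      unfolding D by (rule linear_sum[OF bounded_linear.linear[OF bounded_linear_frobenius], symmetric])
    finally have "c = frobenius ?D N" .
    with c[unfolded has_directional_derivative_def, rule_format, OF \<Theta>]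
    show "((\<lambda>\<epsilon>. (S_cost \<mu> \<circ> E_eval u) (\<Theta> \<epsilon>)) has_real_derivative frobenius ?D N) (at 0)"
      by simp
  qed
  have "is_riemannian_gradient (S_cost \<mu> \<circ> E_eval u) A (?D ** A)"
    unfolding is_riemannian_gradient_def
  proof (intro conjI ballI)
    show "?D ** A \<in> SL_tangent A"
      by (rule tangent[OF traceless_D_matrix])
    fix V assume "V \<in> SL_tangent A"
    then obtain N where "V = N ** A" "trace N = 0"
      by (auto simp: SL_tangent_def)
    then show "has_directional_derivative (S_cost \<mu> \<circ> E_eval u) A V (SL_metric A (?D ** A) V)"
      using derivative by (simp only: SL_metric_eq_frobenius[OF A_SL])
  qed
  with riemannian_grad_eq[OF A_SL] show ?thesis
    by blast
qed

end
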